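(* Let $A:\mathbb R\to\mathbb R^{d\times d}$ be a continuous map. The following statements are equivalent: (a) the equation $x'=A(t)x$, $t\in\mathbb R$, is Hyers-Ulam stable; (b) the equation $x'=A(t)x$, $t\in\mathbb R$, admits a summable trichotomy.
   Context: $\mathbb R^d$ carries some norm $|\cdot|$, and $\|\cdot\|$ is the associated operator norm. $T(t,s)$, $t,s\in\mathbb R$, denotes the evolution family of $x'=A(t)x$, i.e. $x(t)=T(t,s)x(s)$ for every solution $x$. Hyers-Ulam stability: there is $L>0$ such that for each $\delta>0$ and each continuously differentiable $y:\mathbb R\to\mathbb R^d$ with $\sup_{t\in\mathbb R}|y'(t)-A(t)y(t)|\le\delta$ there is a solution $x:\mathbb R\to\mathbb R^d$ of $x'=A(t)x$ with $\sup_{t\in\mathbb R}|x(t)-y(t)|\le L\delta$. Summable dichotomy: let $J\in\{\mathbb R^+,\mathbb R^-,\mathbb R\}$, where $\mathbb R^+=[0,\infty)$, $\mathbb R^-=(-\infty,0]$. The equation admits a summable dichotomy on $J$ with respect to projections $P(t)$, $t\in J$, on $\mathbb R^d$ if $T(t,s)P(s)=P(t)T(t,s)$ for all $t,s\in J$ and there is $K>0$ such that for all $t\in J$, $$\int_{\inf J}^t\|T(t,s)P(s)\|\,ds+\int_t^{\sup J}\|T(t,s)Q(s)\|\,ds\le K,\qquad Q(s)=\mathrm{Id}-P(s).$$ Summable trichotomy: the equation admits a summable dichotomy on $\mathbb R^+$ with respect to some projections $P^+(t)$, $t\ge0$, and a summable dichotomy on $\mathbb R^-$ with respect to some projections $P^-(t)$,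 $t\le0$, such that $P^-(0)=P^-(0)P^+(0)=P^+(0)P^-(0)$. *)

theory Defs
  imports "HOL-Analysis.Analysis"
begin

(* The library type real^'d carries the Euclidean norm; nrm is an arbitrary norm on the same
   space. Derivatives and continuity refer to the library topology, which every norm induces
   since the space is finite-dimensional. *)

definition is_norm :: "(real^'d \<Rightarrow> real) \<Rightarrow> bool" where
  "is_norm nrm \<longleftrightarrow>
     (\<forall>x. 0 \<le> nrm x) \<and> (\<forall>x. nrm x = 0 \<longleftrightarrow> x = 0) \<and>
     (\<forall>c x. nrm (c *\<^sub>R x) = \<bar>c\<bar> * nrm x) \<and>
     (\<forall>x y. nrm (x + y) \<le> nrm x + nrm y)"

(* Same shape as the library's onorm; the quotient at x = 0 is 0 / 0 = 0. *)
definition op_norm :: "(real^'d \<Rightarrow> real) \<Rightarrow> real^'d^'d \<Rightarrow> real" where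
  "op_norm nrm M = (SUP x. nrm (M *v x) / nrm x)"

definition is_solution :: "(real \<Rightarrow> real^'d^'d) \<Rightarrow> (real \<Rightarrow> real^'d) \<Rightarrow> bool" where
  "is_solution A x \<longleftrightarrow> (\<forall>t. (x has_vector_derivative A t *v x t) (at t))"

(* For continuous A every initial value problem has a unique global solution, so exactly one
   family T has the property under THE. *)
definition evolution_family :: "(real \<Rightarrow> real^'d^'d) \<Rightarrow> real \<Rightarrow> real \<Rightarrow> real^'d^'d" where
  "evolution_family A =
     (THE T. \<forall>x. is_solution A x \<longrightarrow> (\<forall>t s. x t = T t s *v x s))"

(* "sup \<le> c" is stated pointwise, because a supremum in type real is meaningless for
   unbounded functions. *)
definition hyers_ulam_stable :: "(real^'d \<Rightarrow> real) \<Rightarrow> (real \<Rightarrow> real^'d^'d) \<Rightarrow> bool" where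
  "hyers_ulam_stable nrm A \<longleftrightarrow>
     (\<exists>L>0. \<forall>\<delta>>0. \<forall>y.
        y C1_differentiable_on UNIV \<and>
        (\<forall>t. nrm (vector_derivative y (at t) - A t *v y t) \<le> \<delta>) \<longrightarrow>
        (\<exists>x. is_solution A x \<and> (\<forall>t. nrm (x t - y t) \<le> L * \<delta>)))"

(* J is meant to be an interval: the integrals over J \<inter> {..t} and J \<inter> {t..} are those from
   inf J to t and from t to sup J. They are nonnegative Lebesgue integrals with values in
   ennreal, so the bound by K includes their convergence. The integrands are continuous in s
   on J, because the invariance condition gives P s = T s r ** P r ** T r s. Values of P
   outside J are irrelevant. *)
definition summable_dichotomy_on ::
  "(real^'d \<Rightarrow> real) \<Rightarrow> (real \<Rightarrow> real^'d^'d) \<Rightarrow> real set \<Rightarrow> (real \<Rightarrow> real^'d^'d) \<Rightarrow> bool" where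
  "summable_dichotomy_on nrm A J P \<longleftrightarrow>
     (let T = evolution_family A in
        (\<forall>t\<in>J. P t ** P t = P t) \<and>
        (\<forall>t\<in>J. \<forall>s\<in>J. T t s ** P s = P t ** T t s) \<and>
        (\<exists>K>0. \<forall>t\<in>J.
           (\<integral>\<^sup>+ s\<in>J \<inter> {..t}. ennreal (op_norm nrm (T t s ** P s)) \<partial>lborel) +
           (\<integral>\<^sup>+ s\<in>J \<inter> {t..}. ennreal (op_norm nrm (T t s ** (mat 1 - P s))) \<partial>lborel)
           \<le> ennreal K))"

definition summable_trichotomy :: "(real^'d \<Rightarrow> real) \<Rightarrow> (real \<Rightarrow> real^'d^'d) \<Rightarrow> bool" where
  "summable_trichotomy nrm A \<longleftrightarrow>
     (\<exists>Pplus Pminus.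
        summable_dichotomy_on nrm A {0..} Pplus \<and>
        summable_dichotomy_on nrm A {..0} Pminus \<and>
        Pminus 0 = Pminus 0 ** Pplus 0 \<and>
        Pminus 0 = Pplus 0 ** Pminus 0)"

end

(* The fundamental matrix X with X 0 = 1 and its inverse Y turn y' = A y + f into c' = Y f for
   c = Y y, so stability says: whenever f is bounded by delta, X (c - v) is bounded by L delta for
   some constant vector v.

   From stability to trichotomy: testing with f = phi X v shows that every vector is a sum of an
   initial value bounded on t >= 0 and one bounded on t <= 0. Let P+ project onto the former space
   and 1 - P- onto the latter, with complements orthogonal to their intersection; this gives the
   commutation relations. Testing with f = phi e_j, where phi is supported on one side of t,
   bounds the integrals of phi times the entries of the Green function X t P Y s uniformly for
   |phi| <= 1, and hence the integrals of their absolute values.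

   From trichotomy to stability: X P+ is bounded on t >= 0. The vector v only has to cancel the
   component of c along 1 - P+ as t tends to infinity and the one along P- as t tends to minus
   infinity; the commutation relations make these two conditions independent. *)

theory Submission
  imports Defs
begin

section \<open>Fundamental matrices\<close>

text \<open>Stability provides some solution near a perturbed one but no control over which, and the
  candidates differ by solutions bounded on the whole line. The remedy is to let a perturbation
  bounded by 1 vanish after a time N. Then c is constant from N on, so c(N) - v is an initial value
  bounded on t \<ge> 0, and applying 1 - P+ to it shows (1 - P+) v = (1 - P+) c(N). Only P+ v stays
  undetermined, but with c(0) = 0 the estimate at t = 0 gives |v| \<le> L, and X P+ is bounded by
  some C on t \<ge> 0 because finitely many bounded solutions span its range. Replacing v by (1 -
  P+) v therefore costs at most C L, which is the origin of the constant L + C L. What is then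
  bounded is exactly the Green integral of f. The half-line t \<le> 0 needs no argument of its own:
  it is the half-line t \<ge> 0 of the time-reversed equation, whose stable projection is 1 -
  P-.\<close>

lemma norm_matrix_vector_mult_le:
  fixes M :: "real^'n^'m"
  shows "norm (M *v x) \<le> norm M * norm x"
proof -
  have "norm ((M *v x) $ i) \<le> norm (M $ i) * norm x" for i
    by (simp add: matrix_vector_mul_component Cauchy_Schwarz_ineq2)
  then have "norm (M *v x) \<le> L2_set (\<lambda>i. norm (M $ i) * norm x) UNIV"
    unfolding norm_vec_def[of "M *v x"] by (intro L2_set_mono) auto
  also have "\<dots> = norm M * norm x"
    by (simp add: norm_vec_def[of M] L2_set_left_distrib)
  finally show ?thesis .
qed

text \<open>The library norm of a matrix is the Euclidean norm of its entries (Frobenius), so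
  transposition only exchanges two sums. It lets the rows of \<open>M ** N\<close> be estimated as
  \<open>transpose N\<close> applied to the rows of \<open>M\<close>.\<close>

lemma norm_transpose: "norm (transpose M) = norm (M :: real^'n^'m)"
proof -
  have *: "(norm (N :: real^'k^'l))\<^sup>2 = (\<Sum>i\<in>UNIV. \<Sum>j\<in>UNIV. (N$i$j)\<^sup>2)" for N
    by (simp add: norm_vec_def L2_set_def sum_nonneg)
  have "(norm (transpose M))\<^sup>2 = (norm M)\<^sup>2"
    unfolding * by (subst sum.swap) (simp add: transpose_def)
  then show ?thesis by simp
qed

lemma norm_matrix_mult_le:
  fixes M :: "real^'n^'m" and N :: "real^'k^'n"
  shows "norm (M ** N) \<le> norm M * norm N"
proof -
  have "(M ** N) $ i = transpose N *v (M $ i)" for i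
    by (simp add: vec_eq_iff matrix_matrix_mult_def matrix_vector_mult_def transpose_def mult.commute)
  then have "norm ((M ** N) $ i) \<le> norm (M $ i) * norm N" for i
    using norm_matrix_vector_mult_le[of "transpose N" "M $ i"] by (simp add: norm_transpose mult.commute)
  then have "norm (M ** N) \<le> L2_set (\<lambda>i. norm (M $ i) * norm N) UNIV"
    unfolding norm_vec_def[of "M ** N"] by (intro L2_set_mono) auto
  also have "\<dots> = norm M * norm N"
    by (simp add: norm_vec_def[of M] L2_set_left_distrib)
  finally show ?thesis .
qed

lemma bounded_bilinear_matrix_vector_mult:
  "bounded_bilinear ((*v) :: real^'n^'m \<Rightarrow> real^'n \<Rightarrow> real^'m)"
proof
  show "\<exists>K. \<forall>a b. norm ((a::real^'n^'m) *v b) \<le> norm a * norm b * K"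
    using norm_matrix_vector_mult_le by (intro exI[of _ 1]) auto
qed (auto simp: matrix_vector_mult_add_rdistrib matrix_vector_right_distrib
      vec_eq_iff matrix_vector_mult_def sum_distrib_left algebra_simps sum.distrib)

lemma bounded_bilinear_matrix_matrix_mult:
  "bounded_bilinear ((**) :: real^'n^'m \<Rightarrow> real^'k^'n \<Rightarrow> real^'k^'m)"
proof
  show "\<exists>K. \<forall>a b. norm ((a::real^'n^'m) ** (b::real^'k^'n)) \<le> norm a * norm b * K"
    using norm_matrix_mult_le by (intro exI[of _ 1]) auto
qed (auto simp: vec_eq_iff matrix_matrix_mult_def sum_distrib_left algebra_simps sum.distrib)

lemmas continuous_on_matrix_vector_mult [continuous_intros] =
  bounded_bilinear.continuous_on[OF bounded_bilinear_matrix_vector_mult]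
lemmas continuous_on_matrix_matrix_mult [continuous_intros] =
  bounded_bilinear.continuous_on[OF bounded_bilinear_matrix_matrix_mult]
lemmas has_vector_derivative_matrix_vector_mult =
  bounded_bilinear.has_vector_derivative[OF bounded_bilinear_matrix_vector_mult]
lemmas has_vector_derivative_matrix_matrix_mult =
  bounded_bilinear.has_vector_derivative[OF bounded_bilinear_matrix_matrix_mult]
lemmas matrix_mult_sum_right = bounded_bilinear.sum_right[OF bounded_bilinear_matrix_matrix_mult]
lemmas matrix_mult_diff_right = bounded_bilinear.diff_right[OF bounded_bilinear_matrix_matrix_mult]

section \<open>Constant functions and oriented antiderivatives on the line\<close>

lemma has_vector_derivative_zero_imp_const:
  fixes f :: "real \<Rightarrow> 'a::real_normed_vector"
  assumes "convex S" "\<And>t. t \<in> S \<Longrightarrow> (f has_vector_derivative 0) (at t)" "s \<in> S" "t \<in> S"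
  shows "f s = f t"
  using has_derivative_zero_constant[OF assms(1), of f] assms(2-)
  by (metis (no_types, lifting) has_derivative_at_withinI has_vector_derivative_def scale_zero_right ext)

text \<open>The integral from 0 to t with orientation: at least one of the two intervals is empty or
  a point, and its integral is 0.\<close>

definition signed_integral :: "(real \<Rightarrow> 'a::banach) \<Rightarrow> real \<Rightarrow> 'a" where
  "signed_integral f t = integral {0..t} f - integral {t..0} f"

lemma signed_integral_0 [simp]: "signed_integral f 0 = 0"
  by (simp add: signed_integral_def)

lemma has_vector_derivative_signed_integral:
  fixes f :: "real \<Rightarrow> 'a::banach"
  assumes "continuous_on UNIV f"
  shows "(signed_integral f has_vector_derivative f t) (at t)"
proof -
  define R where "R = \<bar>t\<bar> + 1"
  have int: "f integrable_on {a..b}" for a b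
    by (rule integrable_continuous_real) (use assms continuous_on_subset in blast)
  \<comment> \<open>Near t the oriented integral differs by a constant from an integral with base
    point -R, so the derivative at 0, where the two branches meet, needs no special
    treatment.\<close>
  have eq: "signed_integral f u = integral {-R..u} f - integral {-R..0} f" if "u \<in> {-R<..<R}" for u
  proof (cases "u \<ge> 0")
    case True
    have "integral {-R..0} f + integral {0..u} f = integral {-R..u} f"
      by (rule Henstock_Kurzweil_Integration.integral_combine) (use True int in \<open>auto simp: R_def\<close>)
    then show ?thesis using True by (cases "u = 0") (auto simp: signed_integral_def algebra_simps)
  next
    case False
    have "integral {-R..u} f + integral {u..0} f = integral {-R..0} f"
      by (rule Henstock_Kurzweil_Integration.integral_combine) (use False that int in auto)
    then show ?thesis using False by (auto simp: signed_integral_def algebra_simps)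
  qed
  have "((\<lambda>u. integral {-R..u} f) has_vector_derivative f t) (at t within {-R..R})"
    by (rule integral_has_vector_derivative) (use assms continuous_on_subset in \<open>auto simp: R_def\<close>)
  then have "((\<lambda>u. integral {-R..u} f) has_vector_derivative f t) (at t)"
    by (subst (asm) at_within_Icc_at) (auto simp: R_def)
  then have "((\<lambda>u. integral {-R..u} f - integral {-R..0} f) has_vector_derivative f t) (at t)"
    by (auto intro!: derivative_eq_intros)
  then show ?thesis
    by (rule has_vector_derivative_transform_within_open[of _ _ _ "{-R<..<R}"])
       (use eq in \<open>auto simp: R_def\<close>)
qed

text \<open>Each integration raises the power by one and divides by the new exponent; iterated, this
  produces the factorials that make the Peano-Baker series converge. Negative t is reduced to
  positive t by reflection.\<close>

lemma norm_signed_integral_le: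
  fixes f :: "real \<Rightarrow> 'a::banach"
  assumes cont: "continuous_on UNIV f"
    and le: "\<And>s. \<bar>s\<bar> \<le> R \<Longrightarrow> norm (f s) \<le> K * \<bar>s\<bar> ^ n" and t: "\<bar>t\<bar> \<le> R"
  shows "norm (signed_integral f t) \<le> K * \<bar>t\<bar> ^ Suc n / Suc n"
proof -
  have *: "norm (integral {0..u} g) \<le> K * u ^ Suc n / Suc n"
    if "continuous_on UNIV g" "\<And>s. \<bar>s\<bar> \<le> R \<Longrightarrow> norm (g s) \<le> K * \<bar>s\<bar> ^ n" "0 \<le> u" "u \<le> R"
    for g :: "real \<Rightarrow> 'a" and u
  proof -
    have "((\<lambda>s. K * s ^ n) has_integral (K * u ^ Suc n / Suc n - K * 0 ^ Suc n / Suc n)) {0..u}"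
      by (rule fundamental_theorem_of_calculus)
         (use that in \<open>auto intro!: derivative_eq_intros
            simp: has_real_derivative_iff_has_vector_derivative[symmetric] simp del: power_Suc\<close>)
    then have 1: "((\<lambda>s. K * s ^ n) has_integral (K * u ^ Suc n / Suc n)) {0..u}" by simp
    have "norm (integral {0..u} g) \<le> integral {0..u} (\<lambda>s. K * s ^ n)"
    proof (rule Henstock_Kurzweil_Integration.integral_norm_bound_integral)
      show "g integrable_on {0..u}"
        by (rule integrable_continuous_real) (use that continuous_on_subset in blast)
      fix s assume "s \<in> {0..u}"
      then show "norm (g s) \<le> K * s ^ n" using that(2)[of s] that(4) by auto
    qed (use 1 in auto)
    then show ?thesis using integral_unique[OF 1] by simp
  qed
  show ?thesis
  proof (cases "t \<ge> 0")
    case True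
    then show ?thesis using *[OF cont le, of t] t
      by (cases "t = 0") (auto simp: signed_integral_def)
  next
    case False
    have "integral {t..0} f = integral {0..-t} (\<lambda>s. f (-s))"
      using Henstock_Kurzweil_Integration.integral_reflect_real[of 0 t f] by simp
    moreover have "norm (integral {0..-t} (\<lambda>s. f (-s))) \<le> K * (-t) ^ Suc n / Suc n"
    proof (rule *)
      show "continuous_on UNIV (\<lambda>s. f (- s))"
        by (rule continuous_on_compose2[OF cont]) (auto intro: continuous_intros)
      fix s assume "\<bar>s\<bar> \<le> R" then show "norm (f (-s)) \<le> K * \<bar>s\<bar> ^ n" using le[of "-s"] by simp
    qed (use False t in auto)
    ultimately show ?thesis using False by (simp add: signed_integral_def)
  qed
qed

section \<open>The Peano-Baker series\<close>

primrec peano_term :: "(real \<Rightarrow> real^'d^'d) \<Rightarrow> nat \<Rightarrow> real \<Rightarrow> real^'d^'d" where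
  "peano_term B 0 = (\<lambda>t. mat 1)"
| "peano_term B (Suc n) = signed_integral (\<lambda>s. B s ** peano_term B n s)"

lemma continuous_on_peano_term:
  assumes B: "continuous_on UNIV B"
  shows "continuous_on UNIV (peano_term B n)"
proof (induction n)
  case (Suc n)
  have "continuous_on UNIV (\<lambda>s. B s ** peano_term B n s)"
    by (intro continuous_intros B Suc)
  from has_vector_derivative_signed_integral[OF this] show ?case
    by (auto simp: continuous_on_eq_continuous_at intro: has_vector_derivative_continuous)
qed auto

lemma peano_term_has_vector_derivative:
  assumes "continuous_on UNIV B"
  shows "(peano_term B (Suc n) has_vector_derivative B t ** peano_term B n t) (at t)"
  using has_vector_derivative_signed_integral[of "\<lambda>s. B s ** peano_term B n s" t]
  by (simp add: assms continuous_on_matrix_matrix_mult continuous_on_peano_term)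

lemma norm_peano_term_le:
  fixes B :: "real \<Rightarrow> real^'d^'d"
  assumes B: "continuous_on UNIV B" and C: "\<And>s. \<bar>s\<bar> \<le> R \<Longrightarrow> norm (B s) \<le> C" and t: "\<bar>t\<bar> \<le> R"
  shows "norm (peano_term B n t) \<le> norm (mat 1 :: real^'d^'d) * C ^ n / fact n * \<bar>t\<bar> ^ n"
  using t
proof (induction n arbitrary: t)
  case (Suc n)
  have C0: "C \<ge> 0" using C[of t] Suc.prems norm_ge_zero order_trans by blast
  have "norm (peano_term B (Suc n) t) \<le>
      norm (mat 1 :: real^'d^'d) * C ^ Suc n / fact n * \<bar>t\<bar> ^ Suc n / Suc n"
    unfolding peano_term.simps
  proof (rule norm_signed_integral_le)
    fix s assume s: "\<bar>s\<bar> \<le> R"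
    have "norm (B s ** peano_term B n s) \<le> norm (B s) * norm (peano_term B n s)"
      by (rule norm_matrix_mult_le)
    also have "\<dots> \<le> C * (norm (mat 1 :: real^'d^'d) * C ^ n / fact n * \<bar>s\<bar> ^ n)"
      by (rule mult_mono) (use C Suc.IH s C0 in auto)
    finally show "norm (B s ** peano_term B n s) \<le> norm (mat 1 :: real^'d^'d) * C ^ Suc n / fact n * \<bar>s\<bar> ^ n"
      by (simp add: mult_ac)
  qed (use Suc.prems B in \<open>auto intro!: continuous_intros continuous_on_peano_term\<close>)
  then show ?case by (simp add: field_simps)
qed auto

text \<open>The Peano-Baker series converges uniformly on every compact interval, because B is
  bounded there and its terms are dominated by an exponential series. The derivative of each term is
  B times the preceding one, so termwise differentiation reproduces B times the sum.\<close>

lemma fundamental_matrix_exists: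
  fixes B :: "real \<Rightarrow> real^'d^'d"
  assumes B: "continuous_on UNIV B"
  shows "\<exists>X. X 0 = mat 1 \<and> (\<forall>t. (X has_vector_derivative B t ** X t) (at t))"
proof -
  define X where "X t = (\<Sum>n. peano_term B n t)" for t
  have "X 0 = mat 1"
  proof -
    have "peano_term B n 0 = (if n = 0 then mat 1 else 0)" for n by (cases n) auto
    then have "X 0 = (\<Sum>n. if n = 0 then mat 1 else 0)" unfolding X_def by presburger
    then show ?thesis using sums_unique[OF sums_single[of 0 "\<lambda>_. mat 1 :: real^'d^'d"]] by simp
  qed
  moreover have "(X has_vector_derivative B t ** X t) (at t)" for t
  proof -
    define R where "R = \<bar>t\<bar> + 1"
    let ?S = "{-R..R}"
    have tS: "t \<in> ?S" by (auto simp: R_def)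
    have "compact (B ` ?S)"
      by (rule compact_continuous_image) (use B continuous_on_subset in blast, simp)
    then obtain C where C: "C > 0" "\<And>s. s \<in> ?S \<Longrightarrow> norm (B s) \<le> C"
      using compact_imp_bounded bounded_pos by (metis imageI)
    define D where "D = norm (mat 1 :: real^'d^'d)"
    define M where "M n = D * ((C * R) ^ n / fact n)" for n
    have Mb: "norm (peano_term B n s) \<le> M n" if "s \<in> ?S" for n s
    proof -
      have "norm (peano_term B n s) \<le> D * C ^ n / fact n * \<bar>s\<bar> ^ n"
        unfolding D_def by (rule norm_peano_term_le[OF B, of R]) (use C(2) that in \<open>auto simp: abs_le_iff\<close>)
      also have "\<dots> \<le> D * C ^ n / fact n * R ^ n"
        by (rule mult_left_mono) (use that C in \<open>auto intro!: power_mono simp: D_def\<close>)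
      finally show ?thesis by (simp add: M_def power_mult_distrib)
    qed
    have "summable M"
      unfolding M_def using summable_mult[OF summable_exp[of "C * R"], of D]
      by (simp add: divide_inverse mult.commute)
    then have unif: "uniform_limit ?S (\<lambda>n s. \<Sum>i<n. peano_term B i s) X sequentially"
      unfolding X_def using Weierstrass_m_test Mb by blast
    have sums: "(\<lambda>n. peano_term B n s) sums X s" if "s \<in> ?S" for s
      unfolding X_def using summable_comparison_test[OF _ \<open>summable M\<close>] Mb[OF that] by (metis summable_sums)
    define V' where "V' n s = (case n of 0 \<Rightarrow> 0 | Suc m \<Rightarrow> B s ** peano_term B m s)" for n s
    have "\<exists>g. \<forall>s\<in>?S. (\<lambda>n. peano_term B n s) sums g s \<and>
        (g has_derivative (\<lambda>h. h *\<^sub>R (B s ** X s))) (at s within ?S)"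
    proof (rule has_derivative_series[where f' = "\<lambda>n s h. h *\<^sub>R V' n s" and x = t and l = "X t"])
      fix n s assume "s \<in> ?S"
      show "(peano_term B n has_derivative (\<lambda>h. h *\<^sub>R V' n s)) (at s within ?S)"
      proof (cases n)
        case (Suc m)
        then show ?thesis using peano_term_has_vector_derivative[OF B, of m s]
          by (auto simp: V'_def has_vector_derivative_def simp del: peano_term.simps intro: has_derivative_at_withinI)
      qed (auto simp: V'_def)
    next
      fix e :: real assume "e > 0"
      then have "\<forall>\<^sub>F n in sequentially. \<forall>s\<in>?S. dist (\<Sum>i<n. peano_term B i s) (X s) < e / C"
        using unif C by (simp add: uniform_limit_iff)
      \<comment> \<open>The derivative of the sum of n terms is B times the sum of n - 1 terms,
        since the first term is constant; hence the shift. The factor 1 / C compensates the bound C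
        of B.\<close>
      then have "\<forall>\<^sub>F n in sequentially. \<forall>s\<in>?S. dist (\<Sum>i<n - 1. peano_term B i s) (X s) < e / C"
        by (rule eventually_compose_filterlim) (rule filterlim_minus_const_nat_at_top)
      then show "\<forall>\<^sub>F n in sequentially. \<forall>s\<in>?S. \<forall>h.
          norm ((\<Sum>i<n. h *\<^sub>R V' i s) - h *\<^sub>R (B s ** X s)) \<le> e * norm h"
        using eventually_gt_at_top[of 0]
      proof eventually_elim
        case (elim n)
        then obtain m where n: "n = Suc m" by (cases n) auto
        show ?case
        proof (intro ballI allI)
          fix s h assume s: "s \<in> ?S"
          have "(\<Sum>i<n. V' i s) = B s ** (\<Sum>i<m. peano_term B i s)"
            unfolding n sum.lessThan_Suc_shift by (simp add: V'_def matrix_mult_sum_right)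
          then have "(\<Sum>i<n. h *\<^sub>R V' i s) - h *\<^sub>R (B s ** X s)
              = h *\<^sub>R (B s ** ((\<Sum>i<m. peano_term B i s) - X s))"
            by (simp add: scaleR_sum_right[symmetric] matrix_mult_diff_right scaleR_diff_right)
          moreover have "norm (B s ** ((\<Sum>i<m. peano_term B i s) - X s)) \<le> C * (e / C)"
            using elim s n C(1) by (intro norm_matrix_mult_le[THEN order_trans] mult_mono C(2)) (auto simp: dist_norm intro: less_imp_le)
          ultimately show "norm ((\<Sum>i<n. h *\<^sub>R V' i s) - h *\<^sub>R (B s ** X s)) \<le> e * norm h"
            using C(1) by (simp add: mult.commute[of e] mult_left_mono)
        qed
      qed
    qed (use sums tS in auto)
    then obtain g where g: "\<And>s. s \<in> ?S \<Longrightarrow> (\<lambda>n. peano_term B n s) sums g s"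
        "\<And>s. s \<in> ?S \<Longrightarrow> (g has_derivative (\<lambda>h. h *\<^sub>R (B s ** X s))) (at s within ?S)"
      by blast
    have "(g has_vector_derivative B t ** X t) (at t)"
      using g(2)[OF tS] by (subst (asm) at_within_Icc_at) (auto simp: R_def has_vector_derivative_def)
    \<comment> \<open>The differentiable limit \<open>g\<close> is known only on the window; there
      uniqueness of limits identifies it with \<open>X\<close>.\<close>
    then show ?thesis
      by (rule has_vector_derivative_transform_within_open[of _ _ _ "{-R<..<R}"])
         (use sums_unique2[OF g(1) sums] in \<open>auto simp: R_def\<close>)
  qed
  ultimately show ?thesis by blast
qed

section \<open>Norms, integrals and projections\<close>

text \<open>Expansion in the standard basis gives the upper bound, which makes \<open>nrm\<close>
  Lipschitz and hence continuous; its minimum on the compact Euclidean unit sphere gives the lower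
  bound.\<close>

lemma is_norm_equivalent:
  fixes nrm :: "real^'d \<Rightarrow> real"
  assumes "is_norm nrm"
  shows "\<exists>m M. 0 < m \<and> 0 < M \<and> (\<forall>x. m * norm x \<le> nrm x \<and> nrm x \<le> M * norm x)"
proof -
  have nonneg: "\<And>x. 0 \<le> nrm x" and zero: "\<And>x. nrm x = 0 \<longleftrightarrow> x = 0"
    and scale: "\<And>c x. nrm (c *\<^sub>R x) = \<bar>c\<bar> * nrm x" and tri: "\<And>x y. nrm (x + y) \<le> nrm x + nrm y"
    using assms by (auto simp: is_norm_def)
  have sum: "nrm (\<Sum>i\<in>I. f i) \<le> (\<Sum>i\<in>I. nrm (f i))" if "finite I" for I :: "'d set" and f
    using that
  proof induction
    case (insert i I)
    then show ?case using tri[of "f i" "\<Sum>i\<in>I. f i"] by simp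
  qed (simp add: zero[THEN iffD2])
  define M where "M = (\<Sum>i\<in>UNIV. nrm (axis i 1 :: real^'d)) + 1"
  have M: "M > 0" unfolding M_def by (intro add_nonneg_pos sum_nonneg) (auto simp: nonneg)
  have up: "nrm x \<le> M * norm x" for x
  proof -
    have "x = (\<Sum>i\<in>UNIV. x $ i *\<^sub>R axis i 1)"
      by (simp add: vec_eq_iff axis_def if_distrib[of "(*) _"] cong: if_cong)
    then have "nrm x \<le> (\<Sum>i\<in>UNIV. nrm (x $ i *\<^sub>R axis i 1))"
      by (metis sum finite_class.finite_UNIV)
    also have "\<dots> \<le> (\<Sum>i\<in>UNIV. norm x * nrm (axis i 1 :: real^'d))"
      by (intro sum_mono) (auto simp: scale nonneg component_le_norm_cart intro!: mult_right_mono)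
    also have "\<dots> \<le> M * norm x"
      by (simp add: M_def sum_distrib_left[symmetric] algebra_simps)
    finally show ?thesis .
  qed
  have lip: "\<bar>nrm x - nrm y\<bar> \<le> M * norm (x - y)" for x y
    using tri[of "x - y" y] tri[of "y - x" x] up[of "x - y"] scale[of "-1" "x - y"] by simp
  have "continuous_on (sphere 0 1) nrm"
    unfolding continuous_on_iff
  proof (intro ballI allI impI)
    fix x :: "real^'d" and e :: real assume "e > 0"
    show "\<exists>d>0. \<forall>x'\<in>sphere 0 1. dist x' x < d \<longrightarrow> dist (nrm x') (nrm x) < e"
    proof (intro exI[of _ "e / M"] conjI ballI impI)
      fix x' assume "dist x' x < e / M"
      then have "M * norm (x' - x) < e" using M by (simp add: dist_norm field_simps)
      then show "dist (nrm x') (nrm x) < e" using lip[of x' x] by (simp add: dist_norm)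
    qed (use \<open>e > 0\<close> M in simp)
  qed
  moreover have "sphere (0 :: real^'d) 1 \<noteq> {}" by simp
  ultimately obtain u :: "real^'d" where u: "u \<in> sphere 0 1" "\<And>x. x \<in> sphere 0 1 \<Longrightarrow> nrm u \<le> nrm x"
    using continuous_attains_inf[of "sphere (0 :: real^'d) 1" nrm] by auto
  have "nrm u > 0" using u(1) nonneg[of u] zero[of u] by (auto simp: less_le)
  moreover have "nrm u * norm x \<le> nrm x" for x
  proof (cases "x = 0")
    case False
    then have "nrm u \<le> nrm ((1 / norm x) *\<^sub>R x)" by (intro u(2)) simp
    then show ?thesis using False by (simp add: scale field_simps)
  qed (simp add: nonneg)
  ultimately show ?thesis using M up by blast
qed

lemma norm_matrix_le_sum_components: "norm (M :: real^'n^'m) \<le> (\<Sum>i\<in>UNIV. \<Sum>j\<in>UNIV. \<bar>M $ i $ j\<bar>)"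
proof -
  have "norm M \<le> (\<Sum>i\<in>UNIV. norm (M $ i))"
    unfolding norm_vec_def[of M] by (rule L2_set_le_sum) simp
  also have "\<dots> \<le> (\<Sum>i\<in>UNIV. \<Sum>j\<in>UNIV. \<bar>M $ i $ j\<bar>)"
    by (intro sum_mono norm_le_l1_cart)
  finally show ?thesis .
qed

text \<open>Evaluating the quotient at a basis vector controls every entry of its column up to M /
  m, and there are d^2 entries to sum. One constant serves both directions because d^2 \<ge>
  1.\<close>

lemma op_norm_equivalent:
  fixes nrm :: "real^'d \<Rightarrow> real"
  assumes "is_norm nrm"
  shows "\<exists>C>0. \<forall>N :: real^'d^'d. norm N \<le> C * op_norm nrm N \<and> op_norm nrm N \<le> C * norm N"
proof -
  obtain m M where m: "0 < m" "\<And>x. m * norm x \<le> nrm x" and M: "0 < M" "\<And>x. nrm x \<le> M * norm x"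
    using is_norm_equivalent[OF assms] by blast
  have le: "nrm (N *v x) / nrm x \<le> (M / m) * norm N" for N :: "real^'d^'d" and x
  proof (cases "x = 0")
    case True
    then show ?thesis using m M assms by (simp add: is_norm_def)
  next
    case False
    then have p: "0 < m * norm x" using m by simp
    have "nrm (N *v x) \<le> M * (norm N * norm x)"
      using M order_trans[OF M(2) mult_left_mono[OF norm_matrix_vector_mult_le]] by simp
    then have "nrm (N *v x) / nrm x \<le> M * (norm N * norm x) / (m * norm x)"
      using p m(2)[of x] assms by (intro frac_le) (auto simp: is_norm_def M(1) less_imp_le)
    then show ?thesis using False by simp
  qed
  have up: "op_norm nrm N \<le> (M / m) * norm N" for N :: "real^'d^'d"
    unfolding op_norm_def by (rule cSUP_least) (use le in auto)
  have low: "norm N \<le> of_nat (CARD('d) * CARD('d)) * (M / m) * op_norm nrm N" for N :: "real^'d^'d"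
  proof -
    have "\<bar>N $ i $ j\<bar> \<le> M / m * op_norm nrm N" for i j
    proof -
      let ?e = "axis j 1 :: real^'d"
      have ne: "nrm ?e > 0" using m(2)[of ?e] m(1) by simp
      have "nrm (N *v ?e) / nrm ?e \<le> op_norm nrm N"
        unfolding op_norm_def by (rule cSUP_upper) (use le in \<open>auto intro!: bdd_aboveI2\<close>)
      then have "nrm (N *v ?e) \<le> op_norm nrm N * nrm ?e" using ne by (simp add: field_simps)
      moreover have "op_norm nrm N * nrm ?e \<le> op_norm nrm N * M"
      proof (rule mult_left_mono)
        show "0 \<le> op_norm nrm N"
          using \<open>nrm (N *v ?e) / nrm ?e \<le> op_norm nrm N\<close> assms
          by (smt (verit) divide_nonneg_nonneg is_norm_def)
      qed (use M(2)[of ?e] in simp)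
      moreover have "m * \<bar>N $ i $ j\<bar> \<le> nrm (N *v ?e)"
      proof -
        have "N $ i $ j = (N *v ?e) $ i" by (simp add: matrix_vector_mul_component inner_axis)
        then have "m * \<bar>N $ i $ j\<bar> \<le> m * norm (N *v ?e)"
          using m(1) by (simp add: component_le_norm_cart)
        then show ?thesis using m(2) order_trans by blast
      qed
      ultimately show ?thesis using m(1) by (simp add: field_simps)
    qed
    then have "(\<Sum>i\<in>UNIV. \<Sum>j\<in>UNIV. \<bar>N $ i $ j\<bar>) \<le> (\<Sum>i\<in>(UNIV::'d set). \<Sum>j\<in>(UNIV::'d set). M / m * op_norm nrm N)"
      by (intro sum_mono)
    then show ?thesis using norm_matrix_le_sum_components[of N] by (simp add: mult.assoc)
  qed
  define C where "C = of_nat (CARD('d) * CARD('d)) * (M / m)"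
  have "C \<ge> 1 * (M / m)"
    unfolding C_def by (rule mult_right_mono) (use m M in \<open>auto simp flip: of_nat_mult simp: Suc_le_eq\<close>)
  moreover have "C > 0" unfolding C_def using m M by simp
  ultimately show ?thesis using up low m M unfolding C_def[symmetric]
    by (metis (no_types, opaque_lifting) mult_1 mult_right_mono norm_ge_zero order_trans)
qed

text \<open>The test functions are
  \<open>n d g / (1 + n d \<bar>g\<bar>)\<close> with \<open>d = (s - a) (b - s)\<close>, which tend to the sign of \<open>g\<close> on \<open>(a, b)\<close>.\<close>

lemma integral_abs_le_by_testing:
  fixes g :: "real \<Rightarrow> real"
  assumes g: "continuous_on UNIV g" and ab: "a \<le> b"
    and test: "\<And>\<phi>. continuous_on UNIV \<phi> \<Longrightarrow> (\<And>s. \<bar>\<phi> s\<bar> \<le> 1) \<Longrightarrow> (\<And>s. s \<notin> {a<..<b} \<Longrightarrow> \<phi> s = 0) \<Longrightarrow>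
       integral {a..b} (\<lambda>s. \<phi> s * g s) \<le> K"
  shows "integral {a..b} (\<lambda>s. \<bar>g s\<bar>) \<le> K"
proof -
  define d where "d s = max 0 (s - a) * max 0 (b - s)" for s :: real
  have d0: "d s \<ge> 0" for s by (simp add: d_def)
  define \<phi> where "\<phi> n s = real n * d s * g s / (1 + real n * d s * \<bar>g s\<bar>)" for n s
  have den: "1 + real n * d s * \<bar>g s\<bar> > 0" for n s
    by (intro add_pos_nonneg mult_nonneg_nonneg) (auto simp: d0)
  have cont: "continuous_on UNIV (\<phi> n)" for n
    unfolding \<phi>_def d_def
    by (intro continuous_intros g) (metis d_def den less_irrefl)
  have le1: "\<bar>\<phi> n s\<bar> \<le> 1" for n s
    using den[of n s] d0[of s] by (simp add: \<phi>_def abs_mult)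
  have zero: "\<phi> n s = 0" if "s \<notin> {a<..<b}" for n s
    using that by (auto simp: \<phi>_def d_def)
  \<comment> \<open>The open interval matters: at the endpoints every \<phi> n vanishes, so there
    the products need not tend to |g|.\<close>
  have conv: "(\<lambda>n. integral {a<..<b} (\<lambda>s. \<phi> n s * g s)) \<longlonglongrightarrow> integral {a<..<b} (\<lambda>s. \<bar>g s\<bar>)"
  proof (rule dominated_convergence(2))
    have sub: "continuous_on {a..b} h \<Longrightarrow> h integrable_on {a<..<b}" for h :: "real \<Rightarrow> real"
      using integrable_continuous_real[of a b h] by (simp add: integrable_on_Icc_iff_Ioo)
    show "(\<lambda>s. \<phi> n s * g s) integrable_on {a<..<b}" for n
      by (intro sub continuous_intros continuous_on_subset[OF cont] continuous_on_subset[OF g]) auto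
    show "(\<lambda>s. \<bar>g s\<bar>) integrable_on {a<..<b}"
      by (intro sub continuous_intros continuous_on_subset[OF g]) auto
    show "norm (\<phi> n s * g s) \<le> \<bar>g s\<bar>" for n s
      using le1[of n s] by (simp add: abs_mult mult_left_le_one_le)
    show "(\<lambda>n. \<phi> n s * g s) \<longlonglongrightarrow> \<bar>g s\<bar>" if s: "s \<in> {a<..<b}" for s
    proof (cases "g s = 0")
      case False
      define c where "c = d s * \<bar>g s\<bar>"
      have c: "c > 0" using False s by (simp add: c_def d_def)
      have "filterlim (\<lambda>n. real n * c) at_top sequentially"
        using filterlim_tendsto_pos_mult_at_top[OF tendsto_const c filterlim_real_sequentially]
        by (simp add: mult.commute)
      then have "(\<lambda>n. 1 - 1 / (1 + real n * c)) \<longlonglongrightarrow> 1 - 0"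
        by (intro tendsto_intros tendsto_divide_0[OF tendsto_const] filterlim_at_top_imp_at_infinity
            filterlim_tendsto_add_at_top[OF tendsto_const])
      then have "(\<lambda>n. \<bar>g s\<bar> * (1 - 1 / (1 + real n * c))) \<longlonglongrightarrow> \<bar>g s\<bar> * (1 - 0)"
        by (rule tendsto_mult[OF tendsto_const])
      moreover have "\<bar>g s\<bar> * (1 - 1 / (1 + real n * c)) = \<phi> n s * g s" for n
      proof -
        have "1 + real n * c \<noteq> 0" using den[of n s] by (simp add: c_def mult.assoc)
        then have "\<bar>g s\<bar> * (1 - 1 / (1 + real n * c)) = real n * d s * \<bar>g s\<bar>\<^sup>2 / (1 + real n * c)"
          by (simp add: c_def field_simps power2_eq_square)
        then show ?thesis by (simp add: \<phi>_def c_def power2_eq_square mult_ac)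
      qed
      ultimately show ?thesis by simp
    qed simp
  qed
  have "integral {a<..<b} (\<lambda>s. \<phi> n s * g s) \<le> K" for n
    using test[OF cont le1 zero] by (simp add: integral_open_interval_real[symmetric])
  with conv have "integral {a<..<b} (\<lambda>s. \<bar>g s\<bar>) \<le> K"
    using LIMSEQ_le_const2 by blast
  then show ?thesis by (simp add: integral_open_interval_real)
qed

section \<open>Half-line integrals as suprema of integrals over compact intervals\<close>

lemma nn_integral_Icc_eq_integral:
  fixes f :: "real \<Rightarrow> real"
  assumes "continuous_on UNIV f" "\<And>s. 0 \<le> f s"
  shows "(\<integral>\<^sup>+s\<in>{a..b}. ennreal (f s) \<partial>lborel) = ennreal (integral {a..b} f)"
  by (rule nn_integral_has_integral_lebesgue')
     (use assms in \<open>auto intro!: integrable_integral integrable_continuous_real intro: continuous_on_subset\<close>)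

text \<open>Monotone convergence along {a..a + n}. It trades the extended nonnegative integrals of
  the dichotomy for real integrals over compact intervals, where the fundamental theorem of calculus
  applies.\<close>

lemma nn_integral_Ici_le_iff:
  fixes f :: "real \<Rightarrow> real"
  assumes f: "continuous_on UNIV f" "\<And>s. 0 \<le> f s" and K: "0 \<le> K"
  shows "(\<integral>\<^sup>+s\<in>{a..}. ennreal (f s) \<partial>lborel) \<le> ennreal K \<longleftrightarrow> (\<forall>b\<ge>a. integral {a..b} f \<le> K)"
proof
  assume *: "(\<integral>\<^sup>+s\<in>{a..}. ennreal (f s) \<partial>lborel) \<le> ennreal K"
  show "\<forall>b\<ge>a. integral {a..b} f \<le> K"
  proof (intro allI impI)
    fix b assume "a \<le> b"
    have "(\<integral>\<^sup>+s\<in>{a..b}. ennreal (f s) \<partial>lborel) \<le> (\<integral>\<^sup>+s\<in>{a..}. ennreal (f s) \<partial>lborel)"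
      by (intro nn_integral_mono) (auto simp: indicator_def)
    also note *
    finally show "integral {a..b} f \<le> K"
      using K by (simp add: nn_integral_Icc_eq_integral[OF f] ennreal_le_iff)
  qed
next
  assume *: "\<forall>b\<ge>a. integral {a..b} f \<le> K"
  have [measurable]: "f \<in> borel_measurable borel"
    using f(1) by (rule borel_measurable_continuous_onI)
  have "ennreal (f s) * indicator {a..} s = (SUP n. ennreal (f s) * indicator {a..a + real n} s)" for s
  proof (rule antisym)
    obtain n where "s - a \<le> real n" using real_arch_simple by blast
    then have "ennreal (f s) * indicator {a..} s \<le> ennreal (f s) * indicator {a..a + real n} s"
      by (auto simp: indicator_def)
    then show "ennreal (f s) * indicator {a..} s \<le> (SUP n. ennreal (f s) * indicator {a..a + real n} s)"
      by (rule order_trans) (rule SUP_upper, simp)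
  qed (auto intro!: SUP_least simp: indicator_def)
  then have "(\<integral>\<^sup>+s\<in>{a..}. ennreal (f s) \<partial>lborel)
      = (\<integral>\<^sup>+s. (SUP n. ennreal (f s) * indicator {a..a + real n} s) \<partial>lborel)" by simp
  also have "\<dots> = (SUP n. \<integral>\<^sup>+s\<in>{a..a + real n}. ennreal (f s) \<partial>lborel)"
    by (rule nn_integral_monotone_convergence_SUP) (auto simp: incseq_def le_fun_def indicator_def)
  also have "\<dots> \<le> ennreal K"
    unfolding nn_integral_Icc_eq_integral[OF f] by (rule SUP_least) (use * K in \<open>auto intro!: ennreal_leI\<close>)
  finally show "(\<integral>\<^sup>+s\<in>{a..}. ennreal (f s) \<partial>lborel) \<le> ennreal K" .
qed

text \<open>The right-hand side is reflected because this is the form in which a half-dichotomy of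
  the time-reversed system supplies the bound.\<close>

lemma nn_integral_Iic_le_iff:
  fixes f :: "real \<Rightarrow> real"
  assumes f: "continuous_on UNIV f" "\<And>s. 0 \<le> f s" and K: "0 \<le> K"
  shows "(\<integral>\<^sup>+s\<in>{..a}. ennreal (f s) \<partial>lborel) \<le> ennreal K \<longleftrightarrow> (\<forall>b\<ge>-a. integral {-a..b} (\<lambda>s. f (-s)) \<le> K)"
proof -
  have [measurable]: "f \<in> borel_measurable borel"
    using f(1) by (rule borel_measurable_continuous_onI)
  have "(\<integral>\<^sup>+s\<in>{..a}. ennreal (f s) \<partial>lborel) = (\<integral>\<^sup>+s. ennreal (f (-s)) * indicator {..a} (-s) \<partial>lborel)"
    using nn_integral_real_affine[of "\<lambda>s. ennreal (f s) * indicator {..a} s" "-1" 0] by simp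
  also have "\<dots> = (\<integral>\<^sup>+s\<in>{-a..}. ennreal (f (-s)) \<partial>lborel)"
    by (intro nn_integral_cong) (auto simp: indicator_def)
  finally show ?thesis
    using nn_integral_Ici_le_iff[of "\<lambda>s. f (-s)" K "-a"] f K
    by (simp add: continuous_on_compose2[OF f(1)] continuous_on_minus)
qed

text \<open>Choose some decomposition of each vector; the trivial intersection makes the choice
  unique, and uniqueness forces it to be linear.\<close>

lemma projection_exists:
  fixes S T :: "(real^'d) set"
  assumes S: "subspace S" and T: "subspace T" and ST: "S \<inter> T \<subseteq> {0}"
    and sum: "\<And>v. \<exists>s\<in>S. \<exists>t\<in>T. v = s + t"
  shows "\<exists>P :: real^'d^'d. (\<forall>v. P *v v \<in> S) \<and> (\<forall>v. v - P *v v \<in> T) \<and>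
           (\<forall>v\<in>S. P *v v = v) \<and> (\<forall>v\<in>T. P *v v = 0)"
proof -
  obtain p where p: "\<And>v. p v \<in> S" "\<And>v. v - p v \<in> T"
    using sum by (metis add_diff_cancel_left')
  have uniq: "p v = s" if "s \<in> S" "v - s \<in> T" for v s
  proof -
    have "p v - s \<in> S" using p that S by (simp add: subspace_diff)
    moreover have "p v - s \<in> T" using subspace_diff[OF T that(2) p(2)[of v]] by simp
    ultimately show ?thesis using ST by auto
  qed
  have "linear p"
  proof
    show "p (u + v) = p u + p v" for u v
      using p[of u] p[of v] subspace_add[OF T p(2)[of u] p(2)[of v]]
      by (intro uniq subspace_add[OF S]) (auto simp: algebra_simps)
    show "p (c *\<^sub>R v) = c *\<^sub>R p v" for c v
      using p[of v] subspace_scale[OF T p(2)[of v], of c]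
      by (intro uniq subspace_scale[OF S]) (auto simp: algebra_simps)
  qed
  then have "matrix p *v v = p v" for v by (simp add: matrix_works)
  moreover have "p v = v" if "v \<in> S" for v using that T by (intro uniq) (auto simp: subspace_0)
  moreover have "p v = 0" if "v \<in> T" for v using that S by (intro uniq) (auto simp: subspace_0)
  ultimately show ?thesis using p by (intro exI[of _ "matrix p"]) auto
qed

section \<open>Linear equations and their evolution family\<close>

text \<open>\<open>X\<close> is the fundamental matrix normalised at \<open>0\<close> and \<open>Y\<close> its inverse, obtained as
  the solution of the adjoint equation.\<close>

locale linear_ode =
  fixes A X Y :: "real \<Rightarrow> real^'d^'d"
  assumes A_cont: "continuous_on UNIV A"
    and X_0 [simp]: "X 0 = mat 1" and Y_0 [simp]: "Y 0 = mat 1"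
    and X_deriv: "(X has_vector_derivative A t ** X t) (at t)"
    and Y_deriv: "(Y has_vector_derivative - (Y t ** A t)) (at t)"
begin

text \<open>The adjoint equation is chosen so that the two terms of the product rule cancel; the
  product keeps its value at 0.\<close>

lemma YX [simp]: "Y t ** X t = mat 1"
proof -
  have "((\<lambda>t. Y t ** X t) has_vector_derivative 0) (at t)" for t
  proof -
    have "((\<lambda>t. Y t ** X t) has_vector_derivative Y t ** (A t ** X t) + - (Y t ** A t) ** X t) (at t)"
      by (rule has_vector_derivative_matrix_matrix_mult[OF Y_deriv X_deriv])
    moreover have "Y t ** (A t ** X t) + - (Y t ** A t) ** X t = 0"
      by (simp add: matrix_mul_assoc bounded_bilinear.minus_left[OF bounded_bilinear_matrix_matrix_mult])
    ultimately show ?thesis by simp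
  qed
  then have "Y t ** X t = Y 0 ** X 0"
    by (intro has_vector_derivative_zero_imp_const[of UNIV "\<lambda>t. Y t ** X t"]) auto
  then show ?thesis by simp
qed

lemma XY [simp]: "X t ** Y t = mat 1"
  using YX matrix_left_right_inverse by blast

lemma YX_vec [simp]: "Y t *v (X t *v v) = v" and XY_vec [simp]: "X t *v (Y t *v v) = v"
  by (simp_all add: matrix_vector_mul_assoc)

lemma YX_mat [simp]: "Y t ** (X t ** M) = M" and XY_mat [simp]: "X t ** (Y t ** M) = M"
  by (simp_all add: matrix_mul_assoc)

lemma X_cont: "continuous_on UNIV X" and Y_cont: "continuous_on UNIV Y"
  using X_deriv Y_deriv
  by (auto simp: continuous_on_eq_continuous_at intro: has_vector_derivative_continuous)

lemma is_solution_X: "is_solution A (\<lambda>t. X t *v v)"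
  unfolding is_solution_def
  using has_vector_derivative_matrix_vector_mult[OF X_deriv has_vector_derivative_const]
  by (simp add: matrix_vector_mul_assoc)

lemma has_vector_derivative_Y_mult:
  assumes "(y has_vector_derivative A t *v y t + f) (at t)"
  shows "((\<lambda>t. Y t *v y t) has_vector_derivative Y t *v f) (at t)"
proof -
  have "((\<lambda>t. Y t *v y t) has_vector_derivative Y t *v (A t *v y t + f) + - (Y t ** A t) *v y t) (at t)"
    by (rule has_vector_derivative_matrix_vector_mult[OF Y_deriv assms])
  moreover have "Y t *v (A t *v y t + f) + - (Y t ** A t) *v y t = Y t *v f"
    by (simp add: matrix_vector_right_distrib matrix_vector_mul_assoc
        bounded_bilinear.minus_left[OF bounded_bilinear_matrix_vector_mult])
  ultimately show ?thesis by simp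
qed

lemma has_vector_derivative_X_mult:
  assumes "(c has_vector_derivative Y t *v f) (at t)"
  shows "((\<lambda>t. X t *v c t) has_vector_derivative A t *v (X t *v c t) + f) (at t)"
  using has_vector_derivative_matrix_vector_mult[OF X_deriv assms]
  by (simp add: matrix_vector_mul_assoc add.commute)

lemma is_solution_iff: "is_solution A x \<longleftrightarrow> (\<exists>v. x = (\<lambda>t. X t *v v))"
proof
  assume x: "is_solution A x"
  have "((\<lambda>t. Y t *v x t) has_vector_derivative 0) (at t)" for t
    using has_vector_derivative_Y_mult[of x t 0] x by (simp add: is_solution_def)
  then have "Y t *v x t = Y 0 *v x 0" for t
    by (intro has_vector_derivative_zero_imp_const[of UNIV "\<lambda>t. Y t *v x t"]) auto
  then have "x t = X t *v x 0" for t by (metis XY_vec Y_0 matrix_vector_mul_lid)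
  then show "\<exists>v. x = (\<lambda>t. X t *v v)" by blast
qed (auto simp: is_solution_X)

text \<open>Every vector v is the value at s of the solution with initial value
  \<open>Y s *v v\<close>, so the property under \<open>THE\<close> determines each matrix T t s
  completely.\<close>

lemma evolution_family_eq: "evolution_family A t s = X t ** Y s"
proof -
  have "evolution_family A = (\<lambda>t s. X t ** Y s)"
    unfolding evolution_family_def
  proof (rule the_equality)
    show "\<forall>x. is_solution A x \<longrightarrow> (\<forall>t s. x t = (X t ** Y s) *v x s)"
      by (auto simp: is_solution_iff simp flip: matrix_vector_mul_assoc)
  next
    fix T assume T: "\<forall>x. is_solution A x \<longrightarrow> (\<forall>t s. x t = T t s *v x s)"
    have "T t s *v v = (X t ** Y s) *v v" for t s v
      using T[rule_format, OF is_solution_X[of "Y s *v v"], of t s]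
      by (simp add: matrix_vector_mul_assoc)
    then show "T = (\<lambda>t s. X t ** Y s)" by (simp add: matrix_eq fun_eq_iff)
  qed
  then show ?thesis by simp
qed

text \<open>Instantiating the locale with this system transfers every result about t \<ge> 0 to t
  \<le> 0.\<close>

lemma reversed: "linear_ode (\<lambda>t. - A (- t)) (\<lambda>t. X (- t)) (\<lambda>t. Y (- t))"
proof
  show "continuous_on UNIV (\<lambda>t. - A (- t))"
    by (intro continuous_intros continuous_on_compose2[OF A_cont]) auto
  have rev: "((\<lambda>t. F (- t)) has_vector_derivative - D) (at t)"
    if "(F has_vector_derivative D) (at (- t))" for F :: "real \<Rightarrow> real^'d^'d" and D t
  proof -
    have "((F \<circ> uminus) has_vector_derivative (- 1) *\<^sub>R D) (at t)"
      by (rule vector_diff_chain_at) (use that in \<open>auto intro!: derivative_eq_intros\<close>)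
    then show ?thesis by (simp add: o_def)
  qed
  show "((\<lambda>t. X (- t)) has_vector_derivative - A (- t) ** X (- t)) (at t)" for t
    using rev[OF X_deriv, of t] by (simp add: bounded_bilinear.minus_left[OF bounded_bilinear_matrix_matrix_mult])
  show "((\<lambda>t. Y (- t)) has_vector_derivative - (Y (- t) ** - A (- t))) (at t)" for t
    using rev[OF Y_deriv, of t] by (simp add: bounded_bilinear.minus_right[OF bounded_bilinear_matrix_matrix_mult])
qed auto

end

text \<open>In the equation for \<open>Y\<close> the unknown multiplies from the left; transposing
  brings it into the form solved by the Peano-Baker series.\<close>

lemma linear_ode_exists:
  fixes A :: "real \<Rightarrow> real^'d^'d"
  assumes A: "continuous_on UNIV A"
  shows "\<exists>X Y. linear_ode A X Y"
proof -
  obtain X where X: "X 0 = mat 1" "\<And>t. (X has_vector_derivative A t ** X t) (at t)"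
    using fundamental_matrix_exists[OF A] by blast
  have tr: "bounded_linear (transpose :: real^'d^'d \<Rightarrow> real^'d^'d)"
    by (intro linear_conv_bounded_linear[THEN iffD1] linearI) (auto simp: transpose_def vec_eq_iff)
  have "continuous_on UNIV (\<lambda>t. - transpose (A t))"
    by (intro continuous_intros bounded_linear.continuous_on[OF tr] A)
  then obtain Z where Z: "Z 0 = mat 1" "\<And>t. (Z has_vector_derivative - transpose (A t) ** Z t) (at t)"
    using fundamental_matrix_exists[of "\<lambda>t. - transpose (A t)"] by blast
  have "((\<lambda>t. transpose (Z t)) has_vector_derivative - (transpose (Z t) ** A t)) (at t)" for t
    using bounded_linear.has_vector_derivative[OF tr Z(2)[of t]]
    by (simp add: matrix_transpose_mul bounded_bilinear.minus_left[OF bounded_bilinear_matrix_matrix_mult]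
        linear_neg[OF bounded_linear.linear[OF tr]])
  then have "linear_ode A X (\<lambda>t. transpose (Z t))"
    using A X Z by unfold_locales (auto simp: transpose_mat)
  then show ?thesis by blast
qed

section \<open>From dichotomies to stability\<close>

text \<open>The dichotomy estimate on t \<ge> 0 for the Frobenius norm, after inserting T(t,s) = X t
  Y s and P(s) = X s P Y s, which give T(t,s) P(s) = X t P Y s. The integral up to infinity is
  encoded as a bound on all integrals up to N.\<close>

definition half_dichotomy :: "(real \<Rightarrow> real^'d^'d) \<Rightarrow> (real \<Rightarrow> real^'d^'d) \<Rightarrow> real^'d^'d \<Rightarrow> real \<Rightarrow> bool" where
  "half_dichotomy X Y P K \<longleftrightarrow> (\<forall>t\<ge>0.
     integral {0..t} (\<lambda>s. norm (X t ** P ** Y s)) \<le> K \<and>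
     (\<forall>N\<ge>t. integral {t..N} (\<lambda>s. norm (X t ** (mat 1 - P) ** Y s)) \<le> K))"

text \<open>Hyers-Ulam stability in the coordinates \<open>c = Y y\<close>, in which \<open>y' = A y + f\<close> reads
  \<open>c' = Y f\<close> and the solutions of the homogeneous equation are the constants.\<close>

definition pulled_back_stable :: "(real \<Rightarrow> real^'d^'d) \<Rightarrow> (real \<Rightarrow> real^'d^'d) \<Rightarrow> real \<Rightarrow> bool" where
  "pulled_back_stable X Y L \<longleftrightarrow> (\<forall>\<delta>>0. \<forall>f c.
     continuous_on UNIV f \<longrightarrow> (\<forall>t. norm (f t) \<le> \<delta>) \<longrightarrow>
     (\<forall>t. (c has_vector_derivative Y t *v f t) (at t)) \<longrightarrow>
     (\<exists>v. \<forall>t. norm (X t *v (c t - v)) \<le> L * \<delta>))"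

definition bounded_initial_values :: "(real \<Rightarrow> real^'d^'d) \<Rightarrow> (real^'d) set" where
  "bounded_initial_values X = {v. \<exists>B. \<forall>t\<ge>0. norm (X t *v v) \<le> B}"

lemma subspace_bounded_initial_values: "subspace (bounded_initial_values X)"
  unfolding bounded_initial_values_def
proof (rule subspaceI; clarify)
  show "\<exists>B. \<forall>t\<ge>0. norm (X t *v 0) \<le> B" by (rule exI[of _ 0]) simp
next
  fix u v B C assume "\<forall>t\<ge>0. norm (X t *v u) \<le> B" "\<forall>t\<ge>0. norm (X t *v v) \<le> C"
  then show "\<exists>B. \<forall>t\<ge>0. norm (X t *v (u + v)) \<le> B"
    by (intro exI[of _ "B + C"]) (auto simp: matrix_vector_right_distrib intro!: norm_triangle_mono)
next
  fix c v B assume "\<forall>t\<ge>0. norm (X t *v v) \<le> B"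
  then show "\<exists>B. \<forall>t\<ge>0. norm (X t *v (c *\<^sub>R v)) \<le> B"
    by (intro exI[of _ "\<bar>c\<bar> * B"]) (auto simp: matrix_vector_mult_scaleR intro!: mult_left_mono)
qed

context linear_ode
begin

lemma X_bounded_Icc: "\<exists>M>0. \<forall>s\<in>{a..b}. norm (X s) \<le> M"
proof -
  have "compact (X ` {a..b})"
    by (rule compact_continuous_image) (use X_cont continuous_on_subset in blast, simp)
  then show ?thesis using compact_imp_bounded bounded_pos by (metis imageI)
qed

text \<open>Solutions are bounded on compact intervals anyway, so a bound from some time on
  suffices. It is applied after the time at which a perturbation has ended.\<close>

lemma bounded_initial_valuesI:
  assumes B: "\<And>t. t \<ge> N \<Longrightarrow> norm (X t *v v) \<le> B"
  shows "v \<in> bounded_initial_values X"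
proof -
  obtain M where M: "M > 0" "\<And>s. s \<in> {0..N} \<Longrightarrow> norm (X s) \<le> M"
    using X_bounded_Icc by blast
  have "norm (X t *v v) \<le> max B (M * norm v)" if "t \<ge> 0" for t
  proof (cases "t \<ge> N")
    case False
    then have "norm (X t *v v) \<le> M * norm v"
      using M(2)[of t] that by (intro order_trans[OF norm_matrix_vector_mult_le] mult_right_mono) auto
    then show ?thesis by simp
  qed (use B in \<open>simp add: le_max_iff_disj\<close>)
  then show ?thesis unfolding bounded_initial_values_def by blast
qed

lemma continuous_on_norm_mult_Y: "continuous_on S (\<lambda>s. norm (M ** Y s))"
  by (intro continuous_intros continuous_on_subset[OF Y_cont]) auto

lemma norm_mult_Y_integrable: "(\<lambda>s. norm (M ** Y s)) integrable_on {a..b}"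
  by (intro integrable_continuous_real continuous_on_norm_mult_Y)

text \<open>For M = X t P or M = X t (1 - P), with t fixed, the integrand is a branch of the Green
  function applied to f, and it is the derivative of s \<mapsto> M c(s).\<close>

lemma has_integral_mult_Y:
  assumes c: "\<And>t. (c has_vector_derivative Y t *v f t) (at t)" and "a \<le> b"
  shows "((\<lambda>s. (M ** Y s) *v f s) has_integral M *v (c b - c a)) {a..b}"
proof -
  have "((\<lambda>s. M *v c s) has_vector_derivative (M ** Y s) *v f s) (at s)" for s
    using bounded_linear.has_vector_derivative[OF matrix_vector_mul_bounded_linear c, of M s]
    by (simp add: matrix_vector_mul_assoc)
  then show ?thesis
    using fundamental_theorem_of_calculus[OF \<open>a \<le> b\<close>, of "\<lambda>s. M *v c s"]
    by (simp add: has_vector_derivative_at_within matrix_vector_mult_diff_distrib)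
qed

lemma norm_mult_increment_le:
  assumes c: "\<And>t. (c has_vector_derivative Y t *v f t) (at t)" and "a \<le> b"
    and f: "\<And>t. norm (f t) \<le> \<delta>"
  shows "norm (M *v (c b - c a)) \<le> integral {a..b} (\<lambda>s. norm (M ** Y s)) * \<delta>"
proof -
  note I = has_integral_mult_Y[OF c \<open>a \<le> b\<close>, of M]
  have "norm (integral {a..b} (\<lambda>s. (M ** Y s) *v f s)) \<le> integral {a..b} (\<lambda>s. norm (M ** Y s) * \<delta>)"
  proof (rule Henstock_Kurzweil_Integration.integral_norm_bound_integral)
    show "(\<lambda>s. norm (M ** Y s) * \<delta>) integrable_on {a..b}"
      by (intro integrable_on_mult_left norm_mult_Y_integrable)
    show "norm ((M ** Y s) *v f s) \<le> norm (M ** Y s) * \<delta>" for s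
      by (intro order_trans[OF norm_matrix_vector_mult_le] mult_left_mono f) auto
  qed (use I in blast)
  then show ?thesis using integral_unique[OF I] by simp
qed

lemma half_dichotomy_nonneg: "half_dichotomy X Y P K \<Longrightarrow> 0 \<le> K"
  by (force simp: half_dichotomy_def dest: spec[of _ 0])

text \<open>\<open>X t P = (X t P Y s) (X s P)\<close>; integrating over \<open>s \<in> [0, 1]\<close> bounds \<open>X t P\<close>.\<close>

lemma half_dichotomy_stable_bounded:
  assumes P: "P ** P = P" and D: "half_dichotomy X Y P K"
  shows "\<exists>C\<ge>0. \<forall>t\<ge>0. \<forall>v. norm (X t *v (P *v v)) \<le> C * norm v"
proof -
  have K: "K \<ge> 0" using D by (rule half_dichotomy_nonneg)
  obtain M where M: "M > 0" "\<And>s. s \<in> {0..1} \<Longrightarrow> norm (X s) \<le> M"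
    using X_bounded_Icc by blast
  define M' where "M' = M * norm P"
  have M': "norm (X s ** P) \<le> M'" if "s \<in> {0..1}" for s
    unfolding M'_def using M(2)[OF that] by (intro order_trans[OF norm_matrix_mult_le] mult_right_mono) auto
  have M'0: "M' \<ge> 0" using M(1) by (simp add: M'_def)
  \<comment> \<open>The first summand covers t \<le> 1, the second t > 1, where [0, 1] lies inside
    the interval of the dichotomy estimate.\<close>
  have "norm (X t ** P) \<le> M' + K * M'" if t: "t \<ge> 0" for t
  proof (cases "t \<le> 1")
    case True
    then show ?thesis using M'[of t] t K M'0 by (simp add: add_increasing2)
  next
    case False
    have "norm (X t ** P) = integral {0..1} (\<lambda>s::real. norm (X t ** P))" by simp
    also have "\<dots> \<le> integral {0..1} (\<lambda>s. norm (X t ** P ** Y s) * M')"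
    proof (rule integral_le)
      fix s :: real assume s: "s \<in> {0..1}"
      have "X t ** P = (X t ** P ** Y s) ** (X s ** P)"
        using P by (simp flip: matrix_mul_assoc)
      then have "norm (X t ** P) \<le> norm (X t ** P ** Y s) * norm (X s ** P)"
        by (metis norm_matrix_mult_le)
      also have "\<dots> \<le> norm (X t ** P ** Y s) * M'"
        by (intro mult_left_mono M' s) auto
      finally show "norm (X t ** P) \<le> norm (X t ** P ** Y s) * M'" .
    qed (auto intro!: integrable_on_mult_left norm_mult_Y_integrable)
    also have "\<dots> = integral {0..1} (\<lambda>s. norm (X t ** P ** Y s)) * M'" by simp
    also have "\<dots> \<le> integral {0..t} (\<lambda>s. norm (X t ** P ** Y s)) * M'"
      using False M'0 by (intro mult_right_mono integral_subset_le norm_mult_Y_integrable) auto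
    also have "\<dots> \<le> K * M'"
      using D t M'0 by (intro mult_right_mono) (auto simp: half_dichotomy_def)
    finally show ?thesis using M'0 by simp
  qed
  then have "norm (X t *v (P *v v)) \<le> (M' + K * M') * norm v" if "t \<ge> 0" for t v
    unfolding matrix_vector_mul_assoc
    using that by (intro order_trans[OF norm_matrix_vector_mult_le] mult_right_mono) auto
  then show ?thesis using M'0 K by (intro exI[of _ "M' + K * M'"]) auto
qed

text \<open>The vector \<open>q\<close> plays the role of the improper integral of \<open>(1 - P) (Y s) (f s)\<close> over
  \<open>s \<ge> 0\<close>; a cluster point of the partial integrals is enough.\<close>

lemma half_dichotomy_bounded_perturbation:
  assumes D: "half_dichotomy X Y P K" and P: "P ** P = P"
    and c: "\<And>t. (c has_vector_derivative Y t *v f t) (at t)" and c0: "c 0 = 0"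
    and f: "\<And>t. norm (f t) \<le> \<delta>"
    and C: "\<And>t v. t \<ge> 0 \<Longrightarrow> norm (X t *v (P *v v)) \<le> C * norm v"
  shows "\<exists>q. (mat 1 - P) *v q = q \<and> norm q \<le> K * \<delta> \<and>
    (\<forall>w. (mat 1 - P) *v w = - q \<longrightarrow> (\<forall>t\<ge>0. norm (X t *v (w + c t)) \<le> 2 * K * \<delta> + C * norm w))"
proof -
  define Q where "Q = mat 1 - P"
  have d0: "\<delta> \<ge> 0" using f[of 0] norm_ge_zero order_trans by blast
  have QQ: "Q ** Q = Q" unfolding Q_def
    by (simp add: P bounded_bilinear.diff_left[OF bounded_bilinear_matrix_matrix_mult] matrix_mult_diff_right)
  have split: "P *v x + Q *v x = x" for x
    by (simp add: Q_def matrix_vector_mult_diff_rdistrib)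
  have stable: "norm (X t *v (P *v c t)) \<le> K * \<delta>" if t: "t \<ge> 0" for t
  proof -
    have "norm ((X t ** P) *v (c t - c 0)) \<le> integral {0..t} (\<lambda>s. norm (X t ** P ** Y s)) * \<delta>"
      by (rule norm_mult_increment_le[OF c t f])
    also have "\<dots> \<le> K * \<delta>"
      using D t d0 by (intro mult_right_mono) (auto simp: half_dichotomy_def)
    finally show ?thesis by (simp add: c0 matrix_vector_mul_assoc)
  qed
  have unstable: "norm (X t *v (Q *v c t - Q *v c N)) \<le> K * \<delta>" if t: "t \<ge> 0" "N \<ge> t" for t N
  proof -
    have "norm ((X t ** Q) *v (c N - c t)) \<le> integral {t..N} (\<lambda>s. norm (X t ** Q ** Y s)) * \<delta>"
      by (rule norm_mult_increment_le[OF c t(2) f])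
    also have "\<dots> \<le> K * \<delta>"
      using D t d0 by (intro mult_right_mono) (auto simp: half_dichotomy_def Q_def)
    finally show ?thesis
      by (simp add: matrix_vector_mul_assoc[symmetric] matrix_vector_mult_diff_distrib norm_minus_commute)
  qed
  define z where "z n = Q *v c (real n)" for n
  \<comment> \<open>At t = 0, where X is the identity and c vanishes, \<open>unstable\<close> bounds
    Q c(n) itself; hence the compact ball.\<close>
  have z: "z n \<in> cball 0 (K * \<delta>)" for n
    using unstable[of 0 "real n"] by (simp add: z_def c0)
  obtain q r where q: "q \<in> cball 0 (K * \<delta>)" "strict_mono r" "(z \<circ> r) \<longlonglongrightarrow> q"
    using compact_cball[of 0 "K * \<delta>"] z unfolding compact_def by metis
  have Qq: "Q *v q = q"
  proof (rule LIMSEQ_unique[OF _ q(3)])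
    have "(\<lambda>n. Q *v (z \<circ> r) n) \<longlonglongrightarrow> Q *v q"
      by (rule bounded_linear.tendsto[OF matrix_vector_mul_bounded_linear q(3)])
    then show "(z \<circ> r) \<longlonglongrightarrow> Q *v q"
      by (simp add: z_def o_def matrix_vector_mul_assoc QQ)
  qed
  have lim: "norm (X t *v (Q *v c t - q)) \<le> K * \<delta>" if t: "t \<ge> 0" for t
  proof (rule tendsto_upperbound)
    show "(\<lambda>n. norm (X t *v (Q *v c t - (z \<circ> r) n))) \<longlonglongrightarrow> norm (X t *v (Q *v c t - q))"
      by (intro tendsto_norm bounded_linear.tendsto[OF matrix_vector_mul_bounded_linear] tendsto_intros q(3))
    have "filterlim (\<lambda>n. real (r n)) at_top sequentially"
      using filterlim_compose[OF filterlim_real_sequentially filterlim_subseq[OF q(2)]] by simp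
    then have "\<forall>\<^sub>F n in sequentially. t \<le> real (r n)" by (simp add: filterlim_at_top)
    then show "\<forall>\<^sub>F n in sequentially. norm (X t *v (Q *v c t - (z \<circ> r) n)) \<le> K * \<delta>"
      by eventually_elim (use unstable t in \<open>simp add: z_def\<close>)
  qed simp
  have "norm (X t *v (w + c t)) \<le> 2 * K * \<delta> + C * norm w" if w: "Q *v w = - q" and t: "t \<ge> 0" for w t
  proof -
    \<comment> \<open>The prescribed Q w = - q turns Q (w + c t) into Q c t - q, which stays bounded
      under X t; the other two summands lie in the range of P and contribute C |w| and K
      \<delta>.\<close>
    have "w + c t = P *v w + P *v c t + (Q *v c t - q)"
      using split[of w] split[of "c t"] w by (metis (no_types, lifting) add.assoc add.commute diff_conv_add_uminus)
    then have "norm (X t *v (w + c t))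
        \<le> norm (X t *v (P *v w)) + norm (X t *v (P *v c t)) + norm (X t *v (Q *v c t - q))"
      by (simp add: matrix_vector_right_distrib) (intro norm_triangle_mono order_refl)
    then show ?thesis using C[OF t, of w] stable[OF t] lim[OF t] by simp
  qed
  then show ?thesis using q(1) Qq unfolding Q_def[symmetric] by (intro exI[of _ q]) auto
qed

lemma trichotomy_imp_pulled_back_stable:
  assumes Pp: "Pp ** Pp = Pp" and Pm: "Pm ** Pm = Pm"
    and comm: "Pm ** Pp = Pm" "Pp ** Pm = Pm"
    and Dp: "half_dichotomy X Y Pp K"
    and Dm: "half_dichotomy (\<lambda>t. X (- t)) (\<lambda>t. Y (- t)) (mat 1 - Pm) K'"
  shows "\<exists>L>0. pulled_back_stable X Y L"
proof -
  interpret rev: linear_ode "\<lambda>t. - A (- t)" "\<lambda>t. X (- t)" "\<lambda>t. Y (- t)"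
    by (rule reversed)
  have idem: "(mat 1 - Pm) ** (mat 1 - Pm) = mat 1 - Pm"
    by (simp add: Pm bounded_bilinear.diff_left[OF bounded_bilinear_matrix_matrix_mult] matrix_mult_diff_right)
  obtain C where C: "C \<ge> 0" "\<And>t v. t \<ge> 0 \<Longrightarrow> norm (X t *v (Pp *v v)) \<le> C * norm v"
    using half_dichotomy_stable_bounded[OF Pp Dp] by blast
  obtain C' where C': "C' \<ge> 0" "\<And>t v. t \<ge> 0 \<Longrightarrow> norm (X (- t) *v ((mat 1 - Pm) *v v)) \<le> C' * norm v"
    using rev.half_dichotomy_stable_bounded[OF idem Dm] by blast
  have K: "K \<ge> 0" "K' \<ge> 0"
    using half_dichotomy_nonneg[OF Dp] rev.half_dichotomy_nonneg[OF Dm] by auto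
  \<comment> \<open>Each half-line costs twice its dichotomy constant, plus C or C' times the bound
    K + K' on |w| / \<delta>. The sum dominates both cases, and the 1 makes it positive.\<close>
  define L where "L = 2 * K + 2 * K' + (C + C') * (K + K') + 1"
  have "\<exists>v. \<forall>t. norm (X t *v (c t - v)) \<le> L * \<delta>"
    if \<delta>: "\<delta> > 0" and f: "\<And>t. norm (f t) \<le> \<delta>"
      and c: "\<And>t. (c has_vector_derivative Y t *v f t) (at t)" for \<delta> f c
  proof -
    \<comment> \<open>The half-line estimate is stated for functions vanishing at 0; the subtracted
      constant reappears in the final vector \<open>c 0 - w\<close>.\<close>
    define b where "b t = c t - c 0" for t
    have b: "(b has_vector_derivative Y t *v f t) (at t)" for t
      unfolding b_def using c by (auto intro!: derivative_eq_intros)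
    have b0: "b 0 = 0" by (simp add: b_def)
    have b': "((\<lambda>t. b (- t)) has_vector_derivative Y (- t) *v - f (- t)) (at t)" for t
    proof -
      have "((b \<circ> uminus) has_vector_derivative (- 1) *\<^sub>R (Y (- t) *v f (- t))) (at t)"
        by (rule vector_diff_chain_at) (use b in \<open>auto intro!: derivative_eq_intros\<close>)
      then show ?thesis
        by (simp add: o_def bounded_bilinear.minus_right[OF bounded_bilinear_matrix_vector_mult])
    qed
    obtain q where q: "(mat 1 - Pp) *v q = q" "norm q \<le> K * \<delta>"
      "\<And>w t. (mat 1 - Pp) *v w = - q \<Longrightarrow> t \<ge> 0 \<Longrightarrow> norm (X t *v (w + b t)) \<le> 2 * K * \<delta> + C * norm w"
      using half_dichotomy_bounded_perturbation[OF Dp Pp b b0 f C(2)] by blast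
    \<comment> \<open>The reversed system has stable projection 1 - Pm, so its complementary
      projection is Pm.\<close>
    obtain q' where q': "Pm *v q' = q'" "norm q' \<le> K' * \<delta>"
      "\<And>w t. Pm *v w = - q' \<Longrightarrow> t \<ge> 0 \<Longrightarrow> norm (X (- t) *v (w + b (- t))) \<le> 2 * K' * \<delta> + C' * norm w"
      using rev.half_dichotomy_bounded_perturbation[OF Dm idem b' _ _ C'(2), of \<delta>] f b0 by auto
    \<comment> \<open>This solves both (1 - Pp) w = - q and Pm w = - q': q lies in the range of 1 -
      Pp and is killed by Pm because Pm Pp = Pm, while q' lies in the range of Pm and is fixed by Pp
      because Pp Pm = Pm.\<close>
    define w where "w = - q' - q"
    have "Pm *v q = 0"
    proof -
      have "Pm *v q = (Pm ** (mat 1 - Pp)) *v q" using q(1) by (simp flip: matrix_vector_mul_assoc)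
      then show ?thesis by (simp add: matrix_mult_diff_right comm)
    qed
    then have w': "Pm *v w = - q'"
      using q'(1) by (simp add: w_def matrix_vector_mult_diff_distrib
          bounded_bilinear.minus_right[OF bounded_bilinear_matrix_vector_mult])
    have "Pp *v q' = q'" using q'(1) comm(2) by (metis matrix_vector_mul_assoc)
    then have w: "(mat 1 - Pp) *v w = - q"
      using q(1) by (simp add: w_def matrix_vector_mult_diff_distrib matrix_vector_mult_diff_rdistrib
          bounded_bilinear.minus_right[OF bounded_bilinear_matrix_vector_mult])
    have "norm w \<le> norm q' + norm q" unfolding w_def by (metis norm_minus_cancel norm_triangle_ineq4)
    then have wn: "norm w \<le> (K + K') * \<delta>" using q(2) q'(2) by (simp add: distrib_right)
    have "norm (X t *v (c t - (c 0 - w))) \<le> L * \<delta>" for t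
    proof -
      have eq: "c t - (c 0 - w) = w + b t" by (simp add: b_def)
      have Cw: "C * norm w \<le> C * ((K + K') * \<delta>)" "C' * norm w \<le> C' * ((K + K') * \<delta>)"
        using wn C(1) C'(1) by (auto intro: mult_left_mono)
      have pos: "0 \<le> C * ((K + K') * \<delta>)" "0 \<le> C' * ((K + K') * \<delta>)" "0 \<le> K * \<delta>" "0 \<le> K' * \<delta>"
        using C(1) C'(1) K \<delta> by auto
      have L: "L * \<delta> = 2 * (K * \<delta>) + 2 * (K' * \<delta>) + C * ((K + K') * \<delta>) + C' * ((K + K') * \<delta>) + \<delta>"
        by (simp add: L_def algebra_simps)
      show ?thesis
      proof (cases "t \<ge> 0")
        case True
        then show ?thesis using q(3)[OF w, of t] Cw pos \<delta> unfolding eq L by linarith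
      next
        case False
        then show ?thesis using q'(3)[OF w', of "- t"] Cw pos \<delta> unfolding eq L by simp
      qed
    qed
    then show ?thesis by blast
  qed
  moreover have "L > 0" unfolding L_def using K C(1) C'(1) by (intro add_nonneg_pos add_nonneg_nonneg) auto
  ultimately show ?thesis unfolding pulled_back_stable_def by blast
qed

end

section \<open>From stability to dichotomies\<close>

context linear_ode
begin

text \<open>For f = \<phi> e_j the kernel contributes its j-th column and component i selects one
  entry, so integrals of entries against \<phi> become increments of a single function c.\<close>

lemma integral_test_mult_Y:
  assumes \<phi>: "continuous_on UNIV \<phi>" and "a \<le> b"
    and c: "\<And>t. (c has_vector_derivative Y t *v (\<phi> t *\<^sub>R axis j 1)) (at t)"
  shows "integral {a..b} (\<lambda>s. \<phi> s * (M ** Y s) $ i $ j) = (M *v (c b - c a)) $ i"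
proof -
  have "((\<lambda>s. ((M ** Y s) *v (\<phi> s *\<^sub>R axis j 1)) $ i) has_integral (M *v (c b - c a)) $ i) {a..b}"
    using has_integral_linear[OF has_integral_mult_Y[OF c \<open>a \<le> b\<close>] bounded_linear_vec_nth]
    by (simp add: o_def)
  moreover have "((M ** Y s) *v (\<phi> s *\<^sub>R axis j 1)) $ i = \<phi> s * (M ** Y s) $ i $ j" for s
    by (simp add: matrix_vector_mult_scaleR matrix_vector_mul_component inner_axis)
  ultimately show ?thesis by (simp add: integral_unique)
qed

lemma integral_norm_mult_Y_le:
  fixes M :: "real^'d^'d"
  assumes "\<And>i j. integral {a..b} (\<lambda>s. \<bar>(M ** Y s) $ i $ j\<bar>) \<le> K"
  shows "integral {a..b} (\<lambda>s. norm (M ** Y s)) \<le> of_nat (CARD('d) * CARD('d)) * K"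
proof -
  have cont: "continuous_on {a..b} (\<lambda>s. \<bar>(M ** Y s) $ i $ j\<bar>)" for i j
    by (intro continuous_intros continuous_on_subset[OF Y_cont]) auto
  note int = integrable_continuous_real[OF cont]
  have "integral {a..b} (\<lambda>s. norm (M ** Y s))
      \<le> integral {a..b} (\<lambda>s. \<Sum>i\<in>UNIV. \<Sum>j\<in>UNIV. \<bar>(M ** Y s) $ i $ j\<bar>)"
    by (intro integral_le norm_mult_Y_integrable integrable_sum int norm_matrix_le_sum_components) auto
  also have "\<dots> = (\<Sum>i\<in>UNIV. \<Sum>j\<in>UNIV. integral {a..b} (\<lambda>s. \<bar>(M ** Y s) $ i $ j\<bar>))"
    by (simp add: integral_sum integrable_sum int)
  also have "\<dots> \<le> (\<Sum>i\<in>(UNIV::'d set). \<Sum>j\<in>(UNIV::'d set). K)"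
    by (intro sum_mono assms)
  finally show ?thesis by (simp add: mult.assoc)
qed

text \<open>One estimate, \<open>key\<close>, yields both integrals. If \<phi> lives on (0, t), take
  N = t: then c t - Q c t = P c t. If \<phi> lives on (t, N), then c t = 0 and only - Q c N is left.
  Bounding each entry separately costs the factor d^2.\<close>

lemma pulled_back_stable_imp_half_dichotomy:
  assumes S: "pulled_back_stable X Y L" and L: "L > 0"
    and range: "\<And>v. P *v v \<in> bounded_initial_values X"
    and id: "\<And>v. v \<in> bounded_initial_values X \<Longrightarrow> P *v v = v"
  shows "\<exists>K. half_dichotomy X Y P K"
proof -
  define Q where "Q = mat 1 - P"
  have "\<forall>j. \<exists>B. \<forall>t\<ge>0. norm (X t *v (P *v axis j 1)) \<le> B"
    using range by (simp add: bounded_initial_values_def)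
  from choice[OF this] obtain B where B: "\<And>j t. t \<ge> 0 \<Longrightarrow> norm (X t *v (P *v axis j 1)) \<le> B j"
    by blast
  define C where "C = (\<Sum>j\<in>UNIV. B j)"
  have C: "norm (X t *v (P *v v)) \<le> C * norm v" if t: "t \<ge> 0" for t v
  proof -
    have "v = (\<Sum>j\<in>UNIV. v $ j *\<^sub>R axis j 1)"
      by (simp add: vec_eq_iff axis_def if_distrib[of "(*) _"] cong: if_cong)
    then have "X t *v (P *v v) = (X t ** P) *v (\<Sum>j\<in>UNIV. v $ j *\<^sub>R axis j 1)"
      by (simp add: matrix_vector_mul_assoc)
    also have "\<dots> = (\<Sum>j\<in>UNIV. v $ j *\<^sub>R (X t *v (P *v axis j 1)))"
      by (simp add: bounded_bilinear.sum_right[OF bounded_bilinear_matrix_vector_mult]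
          matrix_vector_mult_scaleR matrix_vector_mul_assoc)
    also have "norm \<dots> \<le> (\<Sum>j\<in>UNIV. norm v * B j)"
      by (intro sum_norm_le) (auto intro!: mult_mono B t component_le_norm_cart)
    also have "\<dots> = C * norm v" unfolding C_def sum_distrib_left[symmetric] by (rule mult.commute)
    finally show ?thesis .
  qed
  have C0: "C \<ge> 0"
    unfolding C_def by (intro sum_nonneg) (rule order_trans[OF norm_ge_zero B[OF order_refl]])
  define K where "K = L + C * L"
  \<comment> \<open>Since c 0 = 0, the vector c t - Q c N equals P (c t - c 0) - Q (c N - c t);
    under X t this is the Green integral of f.\<close>
  have key: "norm (X t *v (c t - Q *v c N)) \<le> K"
    if f: "continuous_on UNIV f" "\<And>s. norm (f s) \<le> 1" "\<And>s. s \<ge> N \<Longrightarrow> f s = 0"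
      and c: "\<And>s. (c has_vector_derivative Y s *v f s) (at s)" "c 0 = 0" and t: "t \<ge> 0" for f c N t
  proof -
    obtain v where v: "\<And>t. norm (X t *v (c t - v)) \<le> L"
      using S f(1,2) c(1) unfolding pulled_back_stable_def
      by (metis zero_less_one mult.right_neutral)
    have c': "(c has_vector_derivative 0) (at s)" if "s \<ge> N" for s
      using c(1)[of s] f(3)[OF that] by simp
    have const: "c s = c N" if "s \<ge> N" for s
      by (rule has_vector_derivative_zero_imp_const[of "{N..}" c]) (use that c' in auto)
    have "c N - v \<in> bounded_initial_values X"
      by (rule bounded_initial_valuesI[of N _ L]) (metis v const)
    then have "Q *v (c N - v) = 0" by (simp add: Q_def id matrix_vector_mult_diff_rdistrib)
    then have Qc: "Q *v c N = v - P *v v"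
      by (simp add: matrix_vector_mult_diff_distrib) (simp add: Q_def matrix_vector_mult_diff_rdistrib)
    have "norm v \<le> L" using v[of 0] by (simp add: c(2))
    have "X t *v (c t - Q *v c N) = X t *v (c t - v) + X t *v (P *v v)"
      unfolding Qc by (simp add: matrix_vector_mult_diff_distrib)
    also have "norm \<dots> \<le> L + C * norm v"
      by (intro norm_triangle_mono v C t)
    also have "\<dots> \<le> K" using \<open>norm v \<le> L\<close> C0 by (simp add: K_def mult_left_mono)
    finally show ?thesis .
  qed
  have antideriv: "\<exists>c. c 0 = 0 \<and> (\<forall>s. (c has_vector_derivative Y s *v f s) (at s))"
    if "continuous_on UNIV f" for f :: "real \<Rightarrow> real^'d"
    by (rule exI[of _ "signed_integral (\<lambda>s. Y s *v f s)"])
       (auto intro!: has_vector_derivative_signed_integral continuous_on_matrix_vector_mult Y_cont that)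
  have cont: "continuous_on UNIV (\<lambda>s. (M ** Y s) $ i $ j)" for M i j
    by (intro continuous_intros Y_cont)
  have stable: "integral {0..t} (\<lambda>s. \<bar>(X t ** P ** Y s) $ i $ j\<bar>) \<le> K" if t: "t \<ge> 0" for t i j
  proof (rule integral_abs_le_by_testing[OF cont t])
    fix \<phi> :: "real \<Rightarrow> real"
    assume \<phi>: "continuous_on UNIV \<phi>" "\<And>s. \<bar>\<phi> s\<bar> \<le> 1" "\<And>s. s \<notin> {0<..<t} \<Longrightarrow> \<phi> s = 0"
    define f where "f s = \<phi> s *\<^sub>R axis j (1::real)" for s
    have f: "continuous_on UNIV f" "\<And>s. norm (f s) \<le> 1" "\<And>s. s \<ge> t \<Longrightarrow> f s = 0"
      unfolding f_def using \<phi> by (auto intro!: continuous_intros)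
    obtain c where c: "\<And>s. (c has_vector_derivative Y s *v f s) (at s)" "c 0 = 0"
      using antideriv[OF f(1)] by blast
    have "integral {0..t} (\<lambda>s. \<phi> s * (X t ** P ** Y s) $ i $ j) = ((X t ** P) *v (c t - c 0)) $ i"
      by (rule integral_test_mult_Y[OF \<phi>(1) t]) (use c(1) in \<open>simp add: f_def\<close>)
    also have "\<dots> = (X t *v (c t - Q *v c t)) $ i"
      by (simp add: c(2) Q_def matrix_vector_mult_diff_rdistrib matrix_vector_mul_assoc)
    also have "\<dots> \<le> norm (X t *v (c t - Q *v c t))"
      using component_le_norm_cart abs_le_D1 by blast
    also have "\<dots> \<le> K" by (rule key[OF f c t])
    finally show "integral {0..t} (\<lambda>s. \<phi> s * (X t ** P ** Y s) $ i $ j) \<le> K" .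
  qed
  have unstable: "integral {t..N} (\<lambda>s. \<bar>(X t ** Q ** Y s) $ i $ j\<bar>) \<le> K" if t: "t \<ge> 0" "N \<ge> t" for t N i j
  proof (rule integral_abs_le_by_testing[OF cont t(2)])
    fix \<phi> :: "real \<Rightarrow> real"
    assume \<phi>: "continuous_on UNIV \<phi>" "\<And>s. \<bar>\<phi> s\<bar> \<le> 1" "\<And>s. s \<notin> {t<..<N} \<Longrightarrow> \<phi> s = 0"
    define f where "f s = \<phi> s *\<^sub>R axis j (1::real)" for s
    have f: "continuous_on UNIV f" "\<And>s. norm (f s) \<le> 1" "\<And>s. s \<ge> N \<Longrightarrow> f s = 0"
      unfolding f_def using \<phi> by (auto intro!: continuous_intros)
    obtain c where c: "\<And>s. (c has_vector_derivative Y s *v f s) (at s)" "c 0 = 0"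
      using antideriv[OF f(1)] by blast
    have c': "(c has_vector_derivative 0) (at s)" if "s \<in> {0..t}" for s
      using c(1)[of s] \<phi>(3)[of s] that by (simp add: f_def)
    then have "c t = c 0"
      by (intro has_vector_derivative_zero_imp_const[of "{0..t}" c]) (use c' t in auto)
    have "integral {t..N} (\<lambda>s. \<phi> s * (X t ** Q ** Y s) $ i $ j) = ((X t ** Q) *v (c N - c t)) $ i"
      by (rule integral_test_mult_Y[OF \<phi>(1) t(2)]) (use c(1) in \<open>simp add: f_def\<close>)
    also have "\<dots> = - (X t *v (c t - Q *v c N)) $ i"
      using \<open>c t = c 0\<close> c(2)
      by (simp add: matrix_vector_mul_assoc bounded_bilinear.minus_right[OF bounded_bilinear_matrix_vector_mult])
    also have "\<dots> \<le> norm (X t *v (c t - Q *v c N))"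
      using component_le_norm_cart abs_le_D2 by blast
    also have "\<dots> \<le> K" by (rule key[OF f c t(1)])
    finally show "integral {t..N} (\<lambda>s. \<phi> s * (X t ** Q ** Y s) $ i $ j) \<le> K" .
  qed
  have "half_dichotomy X Y P (of_nat (CARD('d) * CARD('d)) * K)"
    unfolding half_dichotomy_def Q_def[symmetric]
    by (intro allI impI conjI integral_norm_mult_Y_le stable unstable)
  then show ?thesis by blast
qed

text \<open>A solution near \<open>\<psi> X v\<close>, where \<open>\<psi>\<close> is a smooth step from \<open>0\<close> to \<open>k > 0\<close>, is bounded for
  \<open>t \<le> 0\<close> and differs from \<open>k X v\<close> by a solution that is bounded for \<open>t \<ge> 0\<close>.\<close>

lemma pulled_back_stable_imp_sum_bounded:
  assumes S: "pulled_back_stable X Y L"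
  shows "\<exists>a\<in>bounded_initial_values X. \<exists>b\<in>bounded_initial_values (\<lambda>t. X (- t)). v = a + b"
proof -
  interpret rev: linear_ode "\<lambda>t. - A (- t)" "\<lambda>t. X (- t)" "\<lambda>t. Y (- t)"
    by (rule reversed)
  \<comment> \<open>Perturbations only have to be continuous, so a continuous bump is enough; its
    antiderivative \<psi> is constant on both sides of [0, 1].\<close>
  define \<eta> where "\<eta> s = max 0 (s * (1 - s))" for s :: real
  have \<eta>: "continuous_on UNIV \<eta>" unfolding \<eta>_def by (intro continuous_intros)
  have \<eta>0: "\<eta> s = 0" if "s \<le> 0 \<or> s \<ge> 1" for s
    using that by (auto simp: \<eta>_def mult_le_0_iff)
  define \<psi> where "\<psi> = signed_integral \<eta>"
  have \<psi>: "(\<psi> has_vector_derivative \<eta> s) (at s)" for s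
    unfolding \<psi>_def by (rule has_vector_derivative_signed_integral[OF \<eta>])
  have \<psi>': "(\<psi> has_vector_derivative 0) (at s)" if "s \<le> 0 \<or> s \<ge> 1" for s
    using \<psi>[of s] \<eta>0[OF that] by simp
  have \<psi>_le: "\<psi> s = 0" if "s \<le> 0" for s
  proof -
    have "\<psi> s = \<psi> 0"
      by (rule has_vector_derivative_zero_imp_const[of "{..0}"]) (use that \<psi>' in auto)
    then show ?thesis by (simp add: \<psi>_def)
  qed
  have \<psi>_ge: "\<psi> s = \<psi> 1" if "s \<ge> 1" for s
    by (rule has_vector_derivative_zero_imp_const[of "{1..}"]) (use that \<psi>' in auto)
  have "\<psi> 0 < \<psi> 1"
  proof (rule DERIV_pos_imp_increasing_open[of 0 1])
    fix s :: real assume "0 < s" "s < 1"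
    then have "\<eta> s > 0" by (simp add: \<eta>_def)
    then show "\<exists>y. (\<psi> has_real_derivative y) (at s) \<and> 0 < y"
      using \<psi> by (auto simp: has_real_derivative_iff_has_vector_derivative)
  next
    show "continuous_on {0..1} \<psi>"
      using \<psi> by (auto intro!: continuous_at_imp_continuous_on has_vector_derivative_continuous)
  qed simp
  then have k: "\<psi> 1 > 0" by (simp add: \<psi>_def)
  obtain M where M: "M > 0" "\<And>s. s \<in> {0..1} \<Longrightarrow> norm (X s) \<le> M"
    using X_bounded_Icc by blast
  define f where "f s = \<eta> s *\<^sub>R (X s *v v)" for s
  \<comment> \<open>The added 1 keeps the bound strictly positive for v = 0, as required of
    \<delta>.\<close>
  have "norm (f s) \<le> M * norm v + 1" for s
  proof (cases "s \<in> {0..1}")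
    case True
    have "\<bar>\<eta> s\<bar> \<le> 1" using True by (auto simp: \<eta>_def mult_le_one)
    then have "norm (f s) \<le> 1 * norm (X s *v v)"
      unfolding f_def norm_scaleR by (intro mult_right_mono) auto
    also have "\<dots> \<le> M * norm v"
      using order_trans[OF norm_matrix_vector_mult_le mult_right_mono[OF M(2)[OF True]]] by simp
    finally show ?thesis by simp
  next
    case False
    then have "f s = 0" using \<eta>0[of s] by (auto simp: f_def)
    then show ?thesis using M(1) by simp
  qed
  moreover have "M * norm v + 1 > 0" using M(1) by (simp add: add_nonneg_pos)
  moreover have "continuous_on UNIV f" unfolding f_def by (intro continuous_intros \<eta> X_cont)
  moreover have "((\<lambda>s. \<psi> s *\<^sub>R v) has_vector_derivative Y s *v f s) (at s)" for s
    using has_vector_derivative_scaleR[of \<psi> "\<eta> s" s UNIV "\<lambda>_. v" 0] \<psi>[of s]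
    by (simp add: f_def matrix_vector_mult_scaleR has_real_derivative_iff_has_vector_derivative)
  ultimately obtain w where w: "\<And>t. norm (X t *v (\<psi> t *\<^sub>R v - w)) \<le> L * (M * norm v + 1)"
    using S unfolding pulled_back_stable_def by meson
  have "\<psi> 1 *\<^sub>R v - w \<in> bounded_initial_values X"
    by (rule bounded_initial_valuesI[of 1 _ "L * (M * norm v + 1)"]) (metis w \<psi>_ge)
  then have a: "(1 / \<psi> 1) *\<^sub>R (\<psi> 1 *\<^sub>R v - w) \<in> bounded_initial_values X"
    by (rule subspace_scale[OF subspace_bounded_initial_values])
  have "0 - w \<in> bounded_initial_values (\<lambda>t. X (- t))"
  proof (rule rev.bounded_initial_valuesI[of 0])
    fix t :: real assume "t \<ge> 0"
    then show "norm (X (- t) *v (0 - w)) \<le> L * (M * norm v + 1)"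
      using w[of "- t"] by (simp add: \<psi>_le)
  qed
  then have b: "(- 1 / \<psi> 1) *\<^sub>R (0 - w) \<in> bounded_initial_values (\<lambda>t. X (- t))"
    by (rule subspace_scale[OF subspace_bounded_initial_values])
  have "v = (1 / \<psi> 1) *\<^sub>R (\<psi> 1 *\<^sub>R v - w) + (- 1 / \<psi> 1) *\<^sub>R (0 - w)"
    using k by (simp add: scaleR_diff_right)
  with a b show ?thesis by blast
qed

text \<open>Reflecting c replaces f(t) by - f(-t), which is again continuous with the same bound, so
  even the constant survives.\<close>

lemma pulled_back_stable_reversed:
  assumes S: "pulled_back_stable X Y L"
  shows "pulled_back_stable (\<lambda>t. X (- t)) (\<lambda>t. Y (- t)) L"
  unfolding pulled_back_stable_def
proof (intro allI impI)
  fix \<delta> f c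
  assume \<delta>: "\<delta> > 0" and f: "continuous_on UNIV f" "\<forall>t. norm (f t) \<le> \<delta>"
    and c: "\<forall>t. (c has_vector_derivative Y (- t) *v f t) (at t)"
  have "((\<lambda>t. c (- t)) has_vector_derivative Y t *v - f (- t)) (at t)" for t
  proof -
    have "((c \<circ> uminus) has_vector_derivative (- 1) *\<^sub>R (Y (- (- t)) *v f (- t))) (at t)"
      by (rule vector_diff_chain_at) (use c in \<open>auto intro!: derivative_eq_intros simp del: minus_minus\<close>)
    then show ?thesis
      by (simp add: o_def bounded_bilinear.minus_right[OF bounded_bilinear_matrix_vector_mult])
  qed
  moreover have "continuous_on UNIV (\<lambda>t. - f (- t))"
    by (intro continuous_intros continuous_on_compose2[OF f(1)]) auto
  moreover have "norm (- f (- t)) \<le> \<delta>" for t using f(2) by simp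
  ultimately obtain v where v: "\<And>t. norm (X t *v (c (- t) - v)) \<le> L * \<delta>"
    using S \<delta> unfolding pulled_back_stable_def
    by (meson \<delta>)
  show "\<exists>v. \<forall>t. norm (X (- t) *v (c t - v)) \<le> L * \<delta>"
    by (rule exI[of _ v]) (metis v minus_minus)
qed

lemma pulled_back_stable_imp_trichotomy:
  assumes S: "pulled_back_stable X Y L" and L: "L > 0"
  shows "\<exists>Pp Pm K K'. Pp ** Pp = Pp \<and> Pm ** Pm = Pm \<and> Pm ** Pp = Pm \<and> Pp ** Pm = Pm \<and>
    half_dichotomy X Y Pp K \<and> half_dichotomy (\<lambda>t. X (- t)) (\<lambda>t. Y (- t)) (mat 1 - Pm) K'"
proof -
  interpret rev: linear_ode "\<lambda>t. - A (- t)" "\<lambda>t. X (- t)" "\<lambda>t. Y (- t)"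
    by (rule reversed)
  define Vp where "Vp = bounded_initial_values X"
  define Vm where "Vm = bounded_initial_values (\<lambda>t. X (- t))"
  define O' where "O' = {v. \<forall>x\<in>Vp \<inter> Vm. orthogonal x v}"
  have sub: "subspace Vp" "subspace Vm" "subspace O'"
    unfolding Vp_def Vm_def O'_def
    by (auto intro: subspace_bounded_initial_values subspace_orthogonal_to_vectors)
  have O0: "v = 0" if "v \<in> Vp" "v \<in> Vm" "v \<in> O'" for v
    using that orthogonal_self[of v] by (auto simp: O'_def)
  have sum: "\<exists>a\<in>Vp. \<exists>b\<in>Vm. v = a + b" for v
    using pulled_back_stable_imp_sum_bounded[OF S] by (simp add: Vp_def Vm_def)
  have decomp: "\<exists>i z. i \<in> Vp \<and> i \<in> Vm \<and> z \<in> O' \<and> v = i + z" for v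
  proof -
    have span: "span (Vp \<inter> Vm) = Vp \<inter> Vm"
      using sub by (simp add: subspace_inter span_eq_iff)
    obtain i z where iz: "i \<in> span (Vp \<inter> Vm)" "\<And>x. x \<in> span (Vp \<inter> Vm) \<Longrightarrow> orthogonal z x" "v = i + z"
      using orthogonal_subspace_decomp_exists[of "Vp \<inter> Vm" v] by metis
    show ?thesis
      by (rule exI[of _ i], rule exI[of _ z]) (use iz span in \<open>auto simp: O'_def orthogonal_commute\<close>)
  qed
  \<comment> \<open>The component of b in the intersection is moved over to a, leaving a remainder
    in O' that still belongs to \<open>Vm\<close>.\<close>
  have sum_p: "\<exists>a\<in>Vp. \<exists>b\<in>Vm \<inter> O'. v = a + b" for v
  proof -
    obtain a b i z where *: "a \<in> Vp" "b \<in> Vm" "v = a + b" "i \<in> Vp" "i \<in> Vm" "z \<in> O'" "b = i + z"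
      using sum[of v] decomp by metis
    then have "z \<in> Vm" using subspace_diff[OF sub(2) *(2) *(5)] by simp
    then show ?thesis using * subspace_add[OF sub(1) *(1) *(4)] by (intro bexI[of _ "a + i"] bexI[of _ z]) auto
  qed
  have sum_m: "\<exists>a\<in>Vp \<inter> O'. \<exists>b\<in>Vm. v = a + b" for v
  proof -
    obtain a b i z where *: "a \<in> Vp" "b \<in> Vm" "v = a + b" "i \<in> Vp" "i \<in> Vm" "z \<in> O'" "a = i + z"
      using sum[of v] decomp by metis
    then have "z \<in> Vp" using subspace_diff[OF sub(1) *(1) *(4)] by simp
    then show ?thesis using * subspace_add[OF sub(2) *(2) *(5)] by (intro bexI[of _ z] bexI[of _ "b + i"]) auto
  qed
  obtain Pp :: "real^'d^'d" where Pp: "\<And>v. Pp *v v \<in> Vp" "\<And>v. v - Pp *v v \<in> Vm \<inter> O'"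
      "\<And>v. v \<in> Vp \<Longrightarrow> Pp *v v = v"
    using projection_exists[of Vp "Vm \<inter> O'"] sub sum_p O0 by (metis IntD1 IntD2 subsetI singletonI subspace_inter)
  obtain Pm :: "real^'d^'d" where Pm: "\<And>v. Pm *v v \<in> Vp \<inter> O'" "\<And>v. v - Pm *v v \<in> Vm"
      "\<And>v. v \<in> Vp \<inter> O' \<Longrightarrow> Pm *v v = v" "\<And>v. v \<in> Vm \<Longrightarrow> Pm *v v = 0"
    using projection_exists[of "Vp \<inter> O'" Vm] sub sum_m O0 by (metis IntD1 IntD2 subsetI singletonI subspace_inter)
  \<comment> \<open>The vectors v - Pp v lie in \<open>Vm\<close>, where Pm vanishes; this gives Pm
    Pp = Pm. The relation Pp Pm = Pm follows from the range of Pm lying in \<open>Vp\<close>, where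
    Pp is the identity.\<close>
  have "Pm *v (Pp *v v) = Pm *v v" for v
  proof -
    have "Pm *v (v - Pp *v v) = 0" using Pp(2)[of v] Pm(4) by blast
    then show ?thesis by (simp add: matrix_vector_mult_diff_distrib)
  qed
  then have alg: "Pp ** Pp = Pp" "Pm ** Pm = Pm" "Pm ** Pp = Pm" "Pp ** Pm = Pm"
    using Pp(1,3) Pm(1,3) by (auto simp: matrix_eq simp flip: matrix_vector_mul_assoc)
  have "\<exists>K. half_dichotomy X Y Pp K"
    by (rule pulled_back_stable_imp_half_dichotomy[OF S L]) (use Pp in \<open>auto simp: Vp_def\<close>)
  moreover have "\<exists>K. half_dichotomy (\<lambda>t. X (- t)) (\<lambda>t. Y (- t)) (mat 1 - Pm) K"
    by (rule rev.pulled_back_stable_imp_half_dichotomy[OF pulled_back_stable_reversed[OF S] L])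
       (use Pm in \<open>auto simp: Vm_def matrix_vector_mult_diff_rdistrib\<close>)
  ultimately show ?thesis using alg by blast
qed

end

section \<open>Translation to the original notions\<close>

text \<open>The constant is pulled out of the integral of the continuous g, and f enters only
  through monotonicity. Hence f may involve \<open>op_norm\<close>, about which only the comparison
  with \<open>norm\<close> is known.\<close>

lemma nn_set_integral_le_scaled:
  fixes f g :: "real \<Rightarrow> real"
  assumes g: "continuous_on UNIV g" "\<And>s. 0 \<le> g s" and S: "S \<in> sets borel"
    and le: "\<And>s. s \<in> S \<Longrightarrow> f s \<le> C * g s" and C: "0 \<le> C"
    and int: "(\<integral>\<^sup>+s\<in>S. ennreal (g s) \<partial>lborel) \<le> ennreal K"
  shows "(\<integral>\<^sup>+s\<in>S. ennreal (f s) \<partial>lborel) \<le> ennreal (C * K)"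
proof -
  have [measurable]: "g \<in> borel_measurable borel" "S \<in> sets borel"
    using g(1) S by (auto intro: borel_measurable_continuous_onI)
  have "(\<integral>\<^sup>+s\<in>S. ennreal (f s) \<partial>lborel) \<le> (\<integral>\<^sup>+s. ennreal C * (ennreal (g s) * indicator S s) \<partial>lborel)"
    using le C g(2) by (intro nn_integral_mono) (auto simp: indicator_def ennreal_mult[symmetric] intro!: ennreal_leI)
  also have "\<dots> = ennreal C * (\<integral>\<^sup>+s\<in>S. ennreal (g s) \<partial>lborel)"
    by (rule nn_integral_cmult) measurable
  also have "\<dots> \<le> ennreal C * ennreal K" using int by (rule mult_left_mono) simp
  also have "\<dots> = ennreal (C * K)" using C by (simp add: ennreal_mult')
  finally show ?thesis .
qed

lemma half_dichotomy_mono: "half_dichotomy X Y P K \<Longrightarrow> K \<le> K' \<Longrightarrow> half_dichotomy X Y P K'"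
  unfolding half_dichotomy_def by (meson order_trans)

lemma ex_half_dichotomy_pos_iff: "(\<exists>K. half_dichotomy X Y P K) \<longleftrightarrow> (\<exists>K>0. half_dichotomy X Y P K)"
proof
  assume "\<exists>K. half_dichotomy X Y P K"
  then obtain K where "half_dichotomy X Y P K" ..
  then have "half_dichotomy X Y P (max K 1)" by (rule half_dichotomy_mono) simp
  then show "\<exists>K>0. half_dichotomy X Y P K" by (intro exI[of _ "max K 1"]) auto
qed auto

context linear_ode
begin

text \<open>Variation of constants in both directions: y = X c with f = y' - A y, and f is
  continuous exactly because y is continuously differentiable. Each passage between
  \<open>nrm\<close> and the Euclidean norm costs a factor M or 1 / m.\<close>

lemma hyers_ulam_stable_iff:
  assumes nrm: "is_norm nrm"
  shows "hyers_ulam_stable nrm A \<longleftrightarrow> (\<exists>L>0. pulled_back_stable X Y L)"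
proof -
  obtain m M where m: "0 < m" "\<And>x. m * norm x \<le> nrm x" and M: "0 < M" "\<And>x. nrm x \<le> M * norm x"
    using is_norm_equivalent[OF nrm] by blast
  show ?thesis
  proof
    assume "hyers_ulam_stable nrm A"
    then obtain L where L: "L > 0" and HU: "\<And>\<delta> y. \<delta> > 0 \<Longrightarrow> y C1_differentiable_on UNIV \<Longrightarrow>
        (\<And>t. nrm (vector_derivative y (at t) - A t *v y t) \<le> \<delta>) \<Longrightarrow>
        \<exists>x. is_solution A x \<and> (\<forall>t. nrm (x t - y t) \<le> L * \<delta>)"
      unfolding hyers_ulam_stable_def by blast
    have "\<exists>v. \<forall>t. norm (X t *v (c t - v)) \<le> L * M / m * \<delta>"
      if \<delta>: "\<delta> > 0" and f: "continuous_on UNIV f" "\<forall>t. norm (f t) \<le> \<delta>"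
        and c: "\<forall>t. (c has_vector_derivative Y t *v f t) (at t)" for \<delta> f c
    proof -
      define y where "y t = X t *v c t" for t
      have y: "(y has_vector_derivative A t *v y t + f t) (at t)" for t
        unfolding y_def using c by (intro has_vector_derivative_X_mult) auto
      have "continuous_on UNIV y"
        using y by (auto simp: continuous_on_eq_continuous_at intro: has_vector_derivative_continuous)
      then have "continuous_on UNIV (\<lambda>t. A t *v y t + f t)"
        by (intro continuous_intros A_cont f)
      then have "y C1_differentiable_on UNIV"
        using y unfolding C1_differentiable_on_def by (intro exI[of _ "\<lambda>t. A t *v y t + f t"]) auto
      moreover have "nrm (vector_derivative y (at t) - A t *v y t) \<le> M * \<delta>" for t
      proof -
        have "nrm (f t) \<le> M * \<delta>"
          using f(2) M by (intro order_trans[OF M(2)] mult_left_mono) auto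
        then show ?thesis by (simp add: vector_derivative_at[OF y])
      qed
      ultimately obtain x where x: "is_solution A x" "\<And>t. nrm (x t - y t) \<le> L * (M * \<delta>)"
        using HU[of "M * \<delta>" y] M(1) \<delta> by auto
      obtain v where v: "x = (\<lambda>t. X t *v v)" using x(1) is_solution_iff by blast
      have "norm (X t *v (c t - v)) \<le> L * M / m * \<delta>" for t
      proof -
        have "m * norm (X t *v (c t - v)) = m * norm (x t - y t)"
          by (simp add: v y_def matrix_vector_mult_diff_distrib norm_minus_commute)
        also have "\<dots> \<le> L * (M * \<delta>)" using m(2) x(2) order_trans by blast
        finally show ?thesis using m(1) by (simp add: field_simps)
      qed
      then show ?thesis by blast
    qed
    then show "\<exists>L>0. pulled_back_stable X Y L"
      unfolding pulled_back_stable_def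
      by (intro exI[of _ "L * M / m"]) (use L M(1) m(1) in auto)
  next
    assume "\<exists>L>0. pulled_back_stable X Y L"
    then obtain L where L: "L > 0" "pulled_back_stable X Y L" by blast
    have "\<exists>x. is_solution A x \<and> (\<forall>t. nrm (x t - y t) \<le> M * L / m * \<delta>)"
      if \<delta>: "\<delta> > 0" and y: "y C1_differentiable_on UNIV"
        and le: "\<forall>t. nrm (vector_derivative y (at t) - A t *v y t) \<le> \<delta>" for \<delta> y
    proof -
      obtain D where D: "\<And>t. (y has_vector_derivative D t) (at t)" "continuous_on UNIV D"
        using y unfolding C1_differentiable_on_def by blast
      define f where "f t = D t - A t *v y t" for t
      have yf: "(y has_vector_derivative A t *v y t + f t) (at t)" for t using D(1) by (simp add: f_def)
      have "continuous_on UNIV y"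
        using D(1) by (auto simp: continuous_on_eq_continuous_at intro: has_vector_derivative_continuous)
      then have "continuous_on UNIV f"
        unfolding f_def by (intro continuous_intros A_cont D(2))
      moreover have "norm (f t) \<le> \<delta> / m" for t
      proof -
        have "m * norm (f t) \<le> nrm (f t)" by (rule m(2))
        also have "\<dots> \<le> \<delta>" using le by (simp add: f_def vector_derivative_at[OF D(1)])
        finally show ?thesis using m(1) by (simp add: field_simps)
      qed
      moreover have "((\<lambda>t. Y t *v y t) has_vector_derivative Y t *v f t) (at t)" for t
        by (rule has_vector_derivative_Y_mult[OF yf])
      moreover have "\<delta> / m > 0" using \<delta> m(1) by simp
      ultimately obtain v where v: "\<And>t. norm (X t *v (Y t *v y t - v)) \<le> L * (\<delta> / m)"
        using L(2) unfolding pulled_back_stable_def by meson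
      have "nrm (X t *v v - y t) \<le> M * L / m * \<delta>" for t
      proof -
        have "norm (X t *v v - y t) \<le> L * (\<delta> / m)"
          using v[of t] by (simp add: matrix_vector_mult_diff_distrib norm_minus_commute)
        then have "nrm (X t *v v - y t) \<le> M * (L * (\<delta> / m))"
          using M by (intro order_trans[OF M(2)] mult_left_mono) auto
        then show ?thesis by simp
      qed
      then show ?thesis using is_solution_X by blast
    qed
    moreover have "M * L / m > 0" using M(1) L(1) m(1) by simp
    ultimately show "hyers_ulam_stable nrm A" unfolding hyers_ulam_stable_def by blast
  qed
qed

text \<open>Invariance forces \<open>P t = X t P\<^sub>0 Y t\<close> with \<open>P\<^sub>0 = P 0\<close>, so a dichotomy is determined by
  one projection.\<close>

lemma summable_dichotomy_on_iff:
  assumes nrm: "is_norm nrm" and J: "0 \<in> J" "J \<in> sets borel"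
  shows "summable_dichotomy_on nrm A J P \<longleftrightarrow>
    P 0 ** P 0 = P 0 \<and> (\<forall>t\<in>J. P t = X t ** P 0 ** Y t) \<and>
    (\<exists>K>0. \<forall>t\<in>J.
      (\<integral>\<^sup>+s\<in>J \<inter> {..t}. ennreal (norm (X t ** P 0 ** Y s)) \<partial>lborel) \<le> ennreal K \<and>
      (\<integral>\<^sup>+s\<in>J \<inter> {t..}. ennreal (norm (X t ** (mat 1 - P 0) ** Y s)) \<partial>lborel) \<le> ennreal K)"
proof -
  obtain C where C: "C > 0" "\<And>N. norm N \<le> C * op_norm nrm N" "\<And>N. op_norm nrm N \<le> C * norm N"
    using op_norm_equivalent[OF nrm] by blast
  have [measurable]: "J \<in> sets borel" by (rule J)
  have invariant: "P s = X s ** P 0 ** Y s"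
    if "\<forall>t\<in>J. \<forall>s\<in>J. evolution_family A t s ** P s = P t ** evolution_family A t s" "s \<in> J" for s
  proof -
    have "X s ** P 0 = P s ** X s" using that J(1) by (force simp: evolution_family_eq)
    then show ?thesis by (simp flip: matrix_mul_assoc)
  qed
  have T: "evolution_family A t s ** P s = X t ** P 0 ** Y s"
    "evolution_family A t s ** (mat 1 - P s) = X t ** (mat 1 - P 0) ** Y s"
    if "P s = X s ** P 0 ** Y s" for t s
    unfolding that evolution_family_eq
    by (simp_all add: matrix_mult_diff_right bounded_bilinear.diff_left[OF bounded_bilinear_matrix_matrix_mult]
        flip: matrix_mul_assoc)
  show ?thesis (is "?L \<longleftrightarrow> ?R")
  proof
    assume ?L
    then have inv: "\<forall>t\<in>J. \<forall>s\<in>J. evolution_family A t s ** P s = P t ** evolution_family A t s"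
      and idem: "P 0 ** P 0 = P 0"
      using J(1) by (auto simp: summable_dichotomy_on_def Let_def)
    obtain K where K: "K > 0" and bound: "\<And>t. t \<in> J \<Longrightarrow>
        (\<integral>\<^sup>+s\<in>J \<inter> {..t}. ennreal (op_norm nrm (evolution_family A t s ** P s)) \<partial>lborel) +
        (\<integral>\<^sup>+s\<in>J \<inter> {t..}. ennreal (op_norm nrm (evolution_family A t s ** (mat 1 - P s))) \<partial>lborel) \<le> ennreal K"
      using \<open>?L\<close> by (auto simp: summable_dichotomy_on_def Let_def)
    have P: "\<And>s. s \<in> J \<Longrightarrow> P s = X s ** P 0 ** Y s" using invariant[OF inv] .
    have le_addD: "a \<le> k \<and> b \<le> k" if "a + b \<le> k" for a b k :: ennreal
      using order_trans[OF _ that, of a] order_trans[OF _ that, of b]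
      by (simp add: add_increasing add_increasing2)
    have scaled: "(\<integral>\<^sup>+s\<in>S. ennreal (norm (N ** Y s)) \<partial>lborel) \<le> ennreal (C * K)"
      if S: "S \<in> sets borel" and le: "(\<integral>\<^sup>+s\<in>S. ennreal (op_norm nrm (N ** Y s)) \<partial>lborel) \<le> ennreal K" for S N
    proof (rule nn_set_integral_le_scaled[OF _ _ S])
      \<comment> \<open>Dividing by C inside the integrand keeps the scaled function continuous and
        below \<open>op_norm\<close>, so the factor C is never pulled out of an integral of
        \<open>op_norm\<close>.\<close>
      show "continuous_on UNIV (\<lambda>s. norm (N ** Y s) / C)"
        using C(1) by (intro continuous_intros Y_cont) auto
      have "(\<integral>\<^sup>+s\<in>S. ennreal (norm (N ** Y s) / C) \<partial>lborel) \<le> (\<integral>\<^sup>+s\<in>S. ennreal (op_norm nrm (N ** Y s)) \<partial>lborel)"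
        using C by (intro nn_integral_mono mult_right_mono ennreal_leI) (auto simp: field_simps)
      then show "(\<integral>\<^sup>+s\<in>S. ennreal (norm (N ** Y s) / C) \<partial>lborel) \<le> ennreal K" using le by (rule order_trans)
    qed (use C(1) in auto)
    have "(\<integral>\<^sup>+s\<in>J \<inter> {..t}. ennreal (norm (X t ** P 0 ** Y s)) \<partial>lborel) \<le> ennreal (C * K) \<and>
      (\<integral>\<^sup>+s\<in>J \<inter> {t..}. ennreal (norm (X t ** (mat 1 - P 0) ** Y s)) \<partial>lborel) \<le> ennreal (C * K)"
      if t: "t \<in> J" for t
    proof -
      have "(\<integral>\<^sup>+s\<in>J \<inter> {..t}. ennreal (op_norm nrm (evolution_family A t s ** P s)) \<partial>lborel)
          = (\<integral>\<^sup>+s\<in>J \<inter> {..t}. ennreal (op_norm nrm (X t ** P 0 ** Y s)) \<partial>lborel)"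
        by (rule nn_integral_cong) (simp add: T(1)[OF P] split: split_indicator)
      moreover have "(\<integral>\<^sup>+s\<in>J \<inter> {t..}. ennreal (op_norm nrm (evolution_family A t s ** (mat 1 - P s))) \<partial>lborel)
          = (\<integral>\<^sup>+s\<in>J \<inter> {t..}. ennreal (op_norm nrm (X t ** (mat 1 - P 0) ** Y s)) \<partial>lborel)"
        by (rule nn_integral_cong) (simp add: T(2)[OF P] split: split_indicator)
      ultimately have "(\<integral>\<^sup>+s\<in>J \<inter> {..t}. ennreal (op_norm nrm (X t ** P 0 ** Y s)) \<partial>lborel) \<le> ennreal K \<and>
        (\<integral>\<^sup>+s\<in>J \<inter> {t..}. ennreal (op_norm nrm (X t ** (mat 1 - P 0) ** Y s)) \<partial>lborel) \<le> ennreal K"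
        using le_addD[OF bound[OF t]] by (simp only:)
      then show ?thesis by (intro conjI scaled) simp_all
    qed
    moreover have "C * K > 0" using K C(1) by simp
    ultimately show ?R using idem P by blast
  next
    assume ?R
    then obtain K where idem: "P 0 ** P 0 = P 0" and P: "\<And>t. t \<in> J \<Longrightarrow> P t = X t ** P 0 ** Y t"
      and K: "K > 0" and bound: "\<And>t. t \<in> J \<Longrightarrow>
        (\<integral>\<^sup>+s\<in>J \<inter> {..t}. ennreal (norm (X t ** P 0 ** Y s)) \<partial>lborel) \<le> ennreal K"
        "\<And>t. t \<in> J \<Longrightarrow> (\<integral>\<^sup>+s\<in>J \<inter> {t..}. ennreal (norm (X t ** (mat 1 - P 0) ** Y s)) \<partial>lborel) \<le> ennreal K"
      by blast
    have cont: "continuous_on UNIV (\<lambda>s. norm (N ** Y s))" for N by (rule continuous_on_norm_mult_Y)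
    have "P t ** P t = P t" if "t \<in> J" for t
    proof -
      have "P t ** P t = X t ** (P 0 ** P 0) ** Y t"
        unfolding P[OF that] by (simp flip: matrix_mul_assoc)
      then show ?thesis using P[OF that] idem by simp
    qed
    moreover have "evolution_family A t s ** P s = P t ** evolution_family A t s" if "t \<in> J" "s \<in> J" for t s
      unfolding P[OF that(1)] P[OF that(2)] evolution_family_eq by (simp flip: matrix_mul_assoc)
    moreover have "(\<integral>\<^sup>+s\<in>J \<inter> {..t}. ennreal (op_norm nrm (evolution_family A t s ** P s)) \<partial>lborel) +
        (\<integral>\<^sup>+s\<in>J \<inter> {t..}. ennreal (op_norm nrm (evolution_family A t s ** (mat 1 - P s))) \<partial>lborel)
        \<le> ennreal (2 * (C * K))" if t: "t \<in> J" for t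
    proof -
      have "(\<integral>\<^sup>+s\<in>J \<inter> {..t}. ennreal (op_norm nrm (evolution_family A t s ** P s)) \<partial>lborel) \<le> ennreal (C * K)"
        by (rule nn_set_integral_le_scaled[OF cont _ _ _ _ bound(1)[OF t]]) (use C in \<open>auto simp: T[OF P]\<close>)
      moreover have "(\<integral>\<^sup>+s\<in>J \<inter> {t..}. ennreal (op_norm nrm (evolution_family A t s ** (mat 1 - P s))) \<partial>lborel)
          \<le> ennreal (C * K)"
        by (rule nn_set_integral_le_scaled[OF cont _ _ _ _ bound(2)[OF t]]) (use C in \<open>auto simp: T[OF P]\<close>)
      ultimately have "(\<integral>\<^sup>+s\<in>J \<inter> {..t}. ennreal (op_norm nrm (evolution_family A t s ** P s)) \<partial>lborel) +
        (\<integral>\<^sup>+s\<in>J \<inter> {t..}. ennreal (op_norm nrm (evolution_family A t s ** (mat 1 - P s))) \<partial>lborel)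
        \<le> ennreal (C * K) + ennreal (C * K)" by (rule add_mono)
      also have "\<dots> = ennreal (2 * (C * K))" using C(1) K by (simp flip: ennreal_plus)
      finally show ?thesis .
    qed
    moreover have "2 * (C * K) > 0" using C(1) K by simp
    ultimately show ?L
      unfolding summable_dichotomy_on_def Let_def
      by (intro conjI ballI exI[of _ "2 * (C * K)"]) simp_all
  qed
qed

lemma summable_dichotomy_on_nonneg_iff:
  assumes nrm: "is_norm nrm"
  shows "summable_dichotomy_on nrm A {0..} P \<longleftrightarrow>
    P 0 ** P 0 = P 0 \<and> (\<forall>t\<ge>0. P t = X t ** P 0 ** Y t) \<and> (\<exists>K. half_dichotomy X Y (P 0) K)"
proof -
  note cont = continuous_on_norm_mult_Y
  have eq: "{0..} \<inter> {..t} = {0..t}" "t \<ge> 0 \<Longrightarrow> {0..} \<inter> {t..} = {t..}" for t :: real by auto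
  have "half_dichotomy X Y (P 0) K \<longleftrightarrow> (\<forall>t\<ge>0.
      (\<integral>\<^sup>+s\<in>{0..} \<inter> {..t}. ennreal (norm (X t ** P 0 ** Y s)) \<partial>lborel) \<le> ennreal K \<and>
      (\<integral>\<^sup>+s\<in>{0..} \<inter> {t..}. ennreal (norm (X t ** (mat 1 - P 0) ** Y s)) \<partial>lborel) \<le> ennreal K)"
    if "K > 0" for K
    using that unfolding half_dichotomy_def
    by (simp add: eq nn_integral_Icc_eq_integral[OF cont] nn_integral_Ici_le_iff[OF cont] ennreal_le_iff)
  moreover have "(\<exists>K. half_dichotomy X Y (P 0) K) \<longleftrightarrow> (\<exists>K>0. half_dichotomy X Y (P 0) K)"
    by (rule ex_half_dichotomy_pos_iff)
  ultimately have "(\<exists>K. half_dichotomy X Y (P 0) K) \<longleftrightarrow> (\<exists>K>0. \<forall>t\<in>{0..}.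
      (\<integral>\<^sup>+s\<in>{0..} \<inter> {..t}. ennreal (norm (X t ** P 0 ** Y s)) \<partial>lborel) \<le> ennreal K \<and>
      (\<integral>\<^sup>+s\<in>{0..} \<inter> {t..}. ennreal (norm (X t ** (mat 1 - P 0) ** Y s)) \<partial>lborel) \<le> ennreal K)"
    by (simp add: Ball_def cong: conj_cong)
  then show ?thesis
    by (subst summable_dichotomy_on_iff[OF nrm]) (simp_all add: Ball_def)
qed

text \<open>On t \<le> 0 the unbounded interval {..t} carries P, whereas in a half-dichotomy the
  unbounded integral carries the complement. Reflection therefore exchanges the projections, which
  explains \<open>mat 1 - P 0\<close>.\<close>

lemma summable_dichotomy_on_nonpos_iff:
  assumes nrm: "is_norm nrm"
  shows "summable_dichotomy_on nrm A {..0} P \<longleftrightarrow>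
    P 0 ** P 0 = P 0 \<and> (\<forall>t\<le>0. P t = X t ** P 0 ** Y t) \<and>
    (\<exists>K. half_dichotomy (\<lambda>t. X (- t)) (\<lambda>t. Y (- t)) (mat 1 - P 0) K)"
proof -
  note cont = continuous_on_norm_mult_Y
  have eq: "{..0} \<inter> {t..} = {t..0}" "t \<le> 0 \<Longrightarrow> {..0} \<inter> {..t} = {..t}" for t :: real by auto
  have refl: "integral {t..0} (\<lambda>s. norm (N ** Y s)) = integral {0..-t} (\<lambda>s. norm (N ** Y (- s)))" for t N
    using Henstock_Kurzweil_Integration.integral_reflect_real[of 0 t "\<lambda>s. norm (N ** Y s)"] by simp
  have neg: "(\<forall>t\<ge>0. Q t) \<longleftrightarrow> (\<forall>t\<le>0. Q (- t))" for Q :: "real \<Rightarrow> bool"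
    by (metis minus_minus neg_0_le_iff_le neg_le_0_iff_le)
  have "half_dichotomy (\<lambda>t. X (- t)) (\<lambda>t. Y (- t)) (mat 1 - P 0) K \<longleftrightarrow> (\<forall>t\<le>0.
      (\<integral>\<^sup>+s\<in>{..0} \<inter> {..t}. ennreal (norm (X t ** P 0 ** Y s)) \<partial>lborel) \<le> ennreal K \<and>
      (\<integral>\<^sup>+s\<in>{..0} \<inter> {t..}. ennreal (norm (X t ** (mat 1 - P 0) ** Y s)) \<partial>lborel) \<le> ennreal K)"
    if "K > 0" for K
    using that unfolding half_dichotomy_def neg
    by (auto simp add: eq refl nn_integral_Icc_eq_integral[OF cont] nn_integral_Iic_le_iff[OF cont] ennreal_le_iff)
  moreover have "(\<exists>K. half_dichotomy (\<lambda>t. X (- t)) (\<lambda>t. Y (- t)) (mat 1 - P 0) K) \<longleftrightarrow>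
      (\<exists>K>0. half_dichotomy (\<lambda>t. X (- t)) (\<lambda>t. Y (- t)) (mat 1 - P 0) K)"
    by (rule ex_half_dichotomy_pos_iff)
  ultimately have "(\<exists>K. half_dichotomy (\<lambda>t. X (- t)) (\<lambda>t. Y (- t)) (mat 1 - P 0) K) \<longleftrightarrow>
      (\<exists>K>0. \<forall>t\<in>{..0}.
      (\<integral>\<^sup>+s\<in>{..0} \<inter> {..t}. ennreal (norm (X t ** P 0 ** Y s)) \<partial>lborel) \<le> ennreal K \<and>
      (\<integral>\<^sup>+s\<in>{..0} \<inter> {t..}. ennreal (norm (X t ** (mat 1 - P 0) ** Y s)) \<partial>lborel) \<le> ennreal K)"
    by (simp add: Ball_def cong: conj_cong)
  then show ?thesis
    by (subst summable_dichotomy_on_iff[OF nrm]) (simp_all add: Ball_def)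
qed

lemma summable_trichotomy_iff:
  assumes nrm: "is_norm nrm"
  shows "summable_trichotomy nrm A \<longleftrightarrow>
    (\<exists>Pp Pm K K'. Pp ** Pp = Pp \<and> Pm ** Pm = Pm \<and> Pm ** Pp = Pm \<and> Pp ** Pm = Pm \<and>
      half_dichotomy X Y Pp K \<and> half_dichotomy (\<lambda>t. X (- t)) (\<lambda>t. Y (- t)) (mat 1 - Pm) K')"
  (is "_ \<longleftrightarrow> ?R")
proof
  assume "summable_trichotomy nrm A"
  then obtain P P' where P: "summable_dichotomy_on nrm A {0..} P" "summable_dichotomy_on nrm A {..0} P'"
    and comm: "P' 0 ** P 0 = P' 0" "P 0 ** P' 0 = P' 0"
    unfolding summable_trichotomy_def by metis
  obtain K where K: "P 0 ** P 0 = P 0" "half_dichotomy X Y (P 0) K"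
    using summable_dichotomy_on_nonneg_iff[OF nrm] P(1) by blast
  obtain K' where K': "P' 0 ** P' 0 = P' 0"
    "half_dichotomy (\<lambda>t. X (- t)) (\<lambda>t. Y (- t)) (mat 1 - P' 0) K'"
    using summable_dichotomy_on_nonpos_iff[OF nrm] P(2) by blast
  show ?R using K K' comm by blast
next
  assume ?R
  then obtain Pp Pm where "Pp ** Pp = Pp" "Pm ** Pm = Pm" "Pm ** Pp = Pm" "Pp ** Pm = Pm"
    "\<exists>K. half_dichotomy X Y Pp K" "\<exists>K. half_dichotomy (\<lambda>t. X (- t)) (\<lambda>t. Y (- t)) (mat 1 - Pm) K" by blast
  then show "summable_trichotomy nrm A"
    unfolding summable_trichotomy_def summable_dichotomy_on_nonneg_iff[OF nrm] summable_dichotomy_on_nonpos_iff[OF nrm]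
    by (intro exI[of _ "\<lambda>t. X t ** Pp ** Y t"] exI[of _ "\<lambda>t. X t ** Pm ** Y t"]) auto
qed

end

theorem theorem3:
  fixes nrm :: "real^'d \<Rightarrow> real"
    and A :: "real \<Rightarrow> real^'d^'d"
  assumes "is_norm nrm"
    and "continuous_on UNIV A"
  shows "hyers_ulam_stable nrm A \<longleftrightarrow> summable_trichotomy nrm A"
proof -
  obtain X Y where "linear_ode A X Y" using linear_ode_exists[OF assms(2)] by blast
  then interpret linear_ode A X Y .
  show ?thesis
    unfolding hyers_ulam_stable_iff[OF assms(1)] summable_trichotomy_iff[OF assms(1)]
    using pulled_back_stable_imp_trichotomy trichotomy_imp_pulled_back_stable by metis
qed

end
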